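(* Let $\mathcal{G}=([p],E)$ be a DAG, let $\mathcal{I}$ be a collection of intervention targets with $\emptyset\in\mathcal{I}$, and let $\mathcal{T}_{(\mathcal{G},\mathcal{I})}$ be the interventional staged tree for $\mathcal{G}$ and $\mathcal{I}$ (with respect to a linear extension of $\mathcal{G}$). Then the following are equivalent: (1) $\mathcal{T}_{(\mathcal{G},\mathcal{I})}$ is balanced; (2) $\ker(\Psi^{\mathsf{toric}}_{\mathcal{T}_{(\mathcal{G},\mathcal{I})}})=\mathcal{F}_{\mathcal{G},\mathcal{I}}$; (3) $\mathcal{G}$ is a perfect DAG, and for all $I,J\in\mathcal{I}$ we have $I\cup J=\overline{\mathrm{an}}_{\mathcal{G}}(I\cup J)$.
   Context: **Setting.** $\mathcal{G}=([p],E)$ is a directed acyclic graph on $[p]=\{1,\ldots,p\}$; $\mathrm{pa}_{\mathcal{G}}(j)$ is the set of parents of $j$. $\mathcal{G}$ is perfect if for every $k$ any two distinct elements of $\mathrm{pa}_{\mathcal{G}}(k)$ are joined by an edge of $\mathcal{G}$. For $S\subset[p]$, $\overline{\mathrm{an}}_{\mathcal{G}}(S)$ is the union of $S$ with the set of nodes having a directed path in $\mathcal{G}$ to some element of $S$. A linear extension of $\mathcal{G}$ is an ordering $\pi_1\cdots\pi_p$ of $[p]$ in which $i$ precedes $j$ whenever $i\to j\in E$. $(X_1,\ldots,X_p)$ are discrete random variables, $X_k$ having state space $[d_k]=\{1,\ldots,d_k\}$ with $d_k\ge 2$. For $S\subset[p]$, $\mathcal{R}_S=\prod_{i\in S}[d_i]$,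 $\mathcal{R}=\mathcal{R}_{[p]}$, and $\mathbf{x}_S$ is the restriction of $\mathbf{x}$ to $S$. $\mathcal{I}=\{I_0=\emptyset,I_1,\ldots,I_K\}$ is a collection of subsets of $[p]$. **The tree $\mathcal{T}_{(\mathcal{G},\mathcal{I})}$.** After relabeling assume the linear extension is $12\cdots p$. The vertices are a root $r$, vertices $v_0,\ldots,v_K$, and for each $I\in\mathcal{I}$ and $j\in[p]$ a copy $\mathcal{R}^{(I)}_{[j]}$ of $\mathcal{R}_{[j]}$, whose elements are written $x_1^{(I)}\cdots x_j^{(I)}$. The edges are $r\to v_k$; $v_k\to x_1^{(I_k)}$; and $x_1^{(I)}\cdots x_j^{(I)}\to x_1^{(I)}\cdots x_j^{(I)}x_{j+1}^{(I)}$. The labels are pairwise distinct formal symbols $a_I$ ($I\in\mathcal{I}$), $f^{(\emptyset)}(x_j\mid\mathbf{x}_{\mathrm{pa}_{\mathcal{G}}(j)})$ for $j\in[p]$, and $f^{(I)}(x_j\mid\mathbf{x}_{\mathrm{pa}_{\mathcal{G}}(j)})$ for $I\in\mathcal{I}\setminus\{\emptyset\}$, $j\in I$ (one symbol for each choice of $x_j\in[d_j]$ and $\mathbf{x}_{\mathrm{pa}_{\mathcal{G}}(j)}\in\mathcal{R}_{\mathrm{pa}_{\mathcal{G}}(j)}$). The edge labeling $\theta$ is: $\theta(r\to v_k)=a_{I_k}$; the edge from $x_1^{(I)}\cdots x_j^{(I)}$ (or from $v_k$ with $I=I_k$, if $j=0$) to $x_1^{(I)}\cdots x_{j+1}^{(I)}$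 is labeled $f^{(I)}(x_{j+1}\mid\mathbf{x}_{\mathrm{pa}_{\mathcal{G}}(j+1)})$ if $j+1\in I$ and $f^{(\emptyset)}(x_{j+1}\mid\mathbf{x}_{\mathrm{pa}_{\mathcal{G}}(j+1)})$ otherwise. The leaves are the elements of $\mathcal{R}^{(I)}_{[p]}$, $I\in\mathcal{I}$. **Balanced.** Two vertices are in the same stage if the sets of labels on their outgoing edges are equal. For a vertex $v$, the interpolating polynomial $t(v)$ is the sum, over all directed paths $\lambda$ from $v$ to a leaf, of $\prod_{e\in\lambda}\theta(e)$, in the polynomial ring over $\mathbb{R}$ with the labels as indeterminates ($t(v)=1$ if $v$ is a leaf). Vertices $v,w$ in the same stage, with children $v_0,\ldots,v_m$ and $w_0,\ldots,w_m$ indexed so that $\theta(v\to v_i)=\theta(w\to w_i)$, are balanced if $t(v_i)t(w_j)=t(w_i)t(v_j)$ for all $i\ne j$. The tree is balanced if every pair of vertices in the same stage is balanced. **Ideals.** Let $D_{\mathcal{I}}=\{p^{(I)}_{\mathbf{x}}:\mathbf{x}\in\mathcal{R},I\in\mathcal{I}\}$ be indeterminates. $\Psi^{\mathsf{toric}}_{\mathcal{T}_{(\mathcal{G},\mathcal{I})}}$ is the ring map from $\mathbb{R}[D_{\mathcal{I}}]$ to the polynomial ring over $\mathbb{R}$ on all the labels, sending $p^{(I)}_{\mathbf{x}}$ to the product of the labels on the path from $r$ to the leaf $x_1^{(I)}\cdots x_p^{(I)}$, i.e. $$p^{(I)}_{\mathbf{x}}\mapsto a_I\prod_{j\in I}f^{(I)}(x_j\mid\mathbf{x}_{\mathrm{pa}_{\mathcal{G}}(j)})\prod_{j\notin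 I}f^{(\emptyset)}(x_j\mid\mathbf{x}_{\mathrm{pa}_{\mathcal{G}}(j)}).$$ The $\mathcal{I}$-factorization ideal $\mathcal{F}_{\mathcal{G},\mathcal{I}}$ is the kernel of the composition of this map with the quotient by the ideal generated by all sum-to-one relations $\sum_{x\in[d_j]}f^{(I)}(x\mid\mathbf{y})-1$ (for $j\in[p]$, $\mathbf{y}\in\mathcal{R}_{\mathrm{pa}_{\mathcal{G}}(j)}$, and $I=\emptyset$ or $j\in I$). *)

theory Defs
  imports Complex_Main "HOL-Algebra.QuotRing" "HOL-Library.Poly_Mapping" "HOL-Library.FuncSet"
begin

section \<open>Real polynomials in arbitrary indeterminates\<close>

type_synonym 'x mpoly = "('x \<Rightarrow>\<^sub>0 nat) \<Rightarrow>\<^sub>0 real"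

definition Var :: "'x \<Rightarrow> 'x mpoly" where
  "Var x = Poly_Mapping.single (Poly_Mapping.single x 1) 1"

definition Const :: "real \<Rightarrow> 'x mpoly" where
  "Const c = Poly_Mapping.single 0 c"

text \<open>\<open>mpoly_ring X\<close> is \<open>\<real>[X]\<close>, the polynomials all of whose indeterminates lie in \<open>X\<close>.\<close>

definition mpoly_ring :: "'x set \<Rightarrow> 'x mpoly ring" where
  "mpoly_ring X =
     \<lparr>carrier = {q. \<forall>m\<in>Poly_Mapping.keys q. Poly_Mapping.keys m \<subseteq> X},
      mult = (*), one = 1, zero = 0, add = (+)\<rparr>"

text \<open>The \<open>\<real>\<close>-algebra homomorphism that sends each indeterminate \<open>x\<close> to \<open>\<sigma> x\<close>.\<close>

definition mpoly_hom :: "('x \<Rightarrow> 'y mpoly) \<Rightarrow> 'x mpoly \<Rightarrow> 'y mpoly" where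
  "mpoly_hom \<sigma> q =
     (\<Sum>m\<in>Poly_Mapping.keys q.
        Const (Poly_Mapping.lookup q m) *
        (\<Prod>x\<in>Poly_Mapping.keys m. \<sigma> x ^ Poly_Mapping.lookup m x))"


section \<open>Edge-labelled trees\<close>

record ('v, 'l) ltree =
  verts :: "'v set"
  arcs :: "('v \<times> 'v) set"
  lab :: "'v \<times> 'v \<Rightarrow> 'l"

definition leaves :: "('v, 'l) ltree \<Rightarrow> 'v set" where
  "leaves T = {v \<in> verts T. arcs T `` {v} = {}}"

text \<open>A directed path is given by the nonempty list of the vertices it visits.\<close>

definition paths_to_leaves :: "('v, 'l) ltree \<Rightarrow> 'v \<Rightarrow> 'v list set" where
  "paths_to_leaves T v =
     {vs. vs \<noteq> [] \<and> hd vs = v \<and> successively (\<lambda>u w. (u, w) \<in> arcs T) vs \<and> last vs \<in> leaves T}"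

definition path_weight :: "('v, 'l) ltree \<Rightarrow> 'v list \<Rightarrow> 'l mpoly" where
  "path_weight T vs = prod_list (map (\<lambda>e. Var (lab T e)) (zip vs (tl vs)))"

definition interp_poly :: "('v, 'l) ltree \<Rightarrow> 'v \<Rightarrow> 'l mpoly" where
  "interp_poly T v = (\<Sum>vs\<in>paths_to_leaves T v. path_weight T vs)"

definition same_stage :: "('v, 'l) ltree \<Rightarrow> 'v \<Rightarrow> 'v \<Rightarrow> bool" where
  "same_stage T v w \<longleftrightarrow>
     lab T ` {e \<in> arcs T. fst e = v} = lab T ` {e \<in> arcs T. fst e = w}"

text \<open>Below \<open>v\<^sub>1, v\<^sub>2\<close> are two distinct children of \<open>v\<close>, and \<open>w\<^sub>1, w\<^sub>2\<close> are the
  children of \<open>w\<close> that are reached by the same labels.\<close>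

definition balanced_pair :: "('v, 'l) ltree \<Rightarrow> 'v \<Rightarrow> 'v \<Rightarrow> bool" where
  "balanced_pair T v w \<longleftrightarrow>
     (\<forall>v\<^sub>1 v\<^sub>2 w\<^sub>1 w\<^sub>2.
        (v, v\<^sub>1) \<in> arcs T \<and> (v, v\<^sub>2) \<in> arcs T \<and> (w, w\<^sub>1) \<in> arcs T \<and> (w, w\<^sub>2) \<in> arcs T \<and>
        lab T (v, v\<^sub>1) = lab T (w, w\<^sub>1) \<and> lab T (v, v\<^sub>2) = lab T (w, w\<^sub>2) \<and> v\<^sub>1 \<noteq> v\<^sub>2 \<longrightarrow>
        interp_poly T v\<^sub>1 * interp_poly T w\<^sub>2 = interp_poly T w\<^sub>1 * interp_poly T v\<^sub>2)"

definition balanced :: "('v, 'l) ltree \<Rightarrow> bool" where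
  "balanced T \<longleftrightarrow>
     (\<forall>v\<in>verts T. \<forall>w\<in>verts T. same_stage T v w \<longrightarrow> balanced_pair T v w)"


section \<open>Directed acyclic graphs\<close>

definition dag :: "nat \<Rightarrow> (nat \<times> nat) set \<Rightarrow> bool" where
  "dag p E \<longleftrightarrow> E \<subseteq> {1..p} \<times> {1..p} \<and> acyclic E"

definition pa :: "(nat \<times> nat) set \<Rightarrow> nat \<Rightarrow> nat set" where
  "pa E j = {i. (i, j) \<in> E}"

definition perfect :: "nat \<Rightarrow> (nat \<times> nat) set \<Rightarrow> bool" where
  "perfect p E \<longleftrightarrow>
     (\<forall>k\<in>{1..p}. \<forall>i\<in>pa E k. \<forall>j\<in>pa E k. i \<noteq> j \<longrightarrow> (i, j) \<in> E \<or> (j, i) \<in> E)"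

definition an_closure :: "(nat \<times> nat) set \<Rightarrow> nat set \<Rightarrow> nat set" where
  "an_closure E S = S \<union> {i. \<exists>s\<in>S. (i, s) \<in> E\<^sup>+}"

text \<open>The list \<open>\<pi>\<close> is the ordering \<open>\<pi>\<^sub>1 \<dots> \<pi>\<^sub>p\<close>; since lists are indexed from zero,
  \<open>\<pi>\<close> at position \<open>j\<close> is the mathematical \<open>\<pi>\<^sub>j\<^sub>+\<^sub>1\<close>.\<close>

definition linear_extension :: "nat \<Rightarrow> (nat \<times> nat) set \<Rightarrow> nat list \<Rightarrow> bool" where
  "linear_extension p E \<pi> \<longleftrightarrow>
     distinct \<pi> \<and> set \<pi> = {1..p} \<and>
     (\<forall>a<p. \<forall>b<p. (\<pi> ! a, \<pi> ! b) \<in> E \<longrightarrow> a < b)"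


section \<open>Interventional staged trees\<close>

definition states :: "(nat \<Rightarrow> nat) \<Rightarrow> nat set \<Rightarrow> (nat \<Rightarrow> nat) set" where
  "states d S = (\<Pi>\<^sub>E i\<in>S. {1..d i})"

text \<open>\<open>ASym I\<close> is the symbol \<open>a\<^sub>I\<close>, and \<open>FSym I j a y\<close> is the symbol \<open>f\<^sup>(\<^sup>I\<^sup>)(x\<^sub>j = a | y)\<close>, where \<open>y\<close>
  is a state of the parents of \<open>j\<close>.\<close>

datatype label =
    ASym "nat set"
  | FSym "nat set" nat nat "nat \<Rightarrow> nat"

definition labels :: "nat \<Rightarrow> (nat \<Rightarrow> nat) \<Rightarrow> (nat \<times> nat) set \<Rightarrow> nat set set \<Rightarrow> label set" where
  "labels p d E \<I> =
     ASym ` \<I> \<union>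
     {FSym I j a y | I j a y. I \<in> \<I> \<and> j \<in> {1..p} \<and> (I = {} \<or> j \<in> I) \<and>
                           a \<in> {1..d j} \<and> y \<in> states d (pa E j)}"

text \<open>The label \<open>f\<^sup>(\<^sup>I\<^sup>)(x\<^sub>j | x\<^sub>p\<^sub>a\<^sub>(\<^sub>j\<^sub>))\<close> if \<open>j \<in> I\<close>, and \<open>f\<^sup>(\<^sup>\<emptyset>\<^sup>)(x\<^sub>j | x\<^sub>p\<^sub>a\<^sub>(\<^sub>j\<^sub>))\<close> otherwise.\<close>

definition cond_label :: "(nat \<times> nat) set \<Rightarrow> nat set \<Rightarrow> nat \<Rightarrow> (nat \<Rightarrow> nat) \<Rightarrow> label" where
  "cond_label E I j x = FSym (if j \<in> I then I else {}) j (x j) (restrict x (pa E j))"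

text \<open>\<open>Node I j x\<close> is the copy with superscript \<open>(I)\<close> of the state \<open>x\<close> of the first \<open>j\<close>
  variables in the linear extension. The vertex \<open>v\<^sub>k\<close> is \<open>Node I\<^sub>k 0 x\<close> with \<open>x\<close> the only
  element of \<open>states d {}\<close>. The depth \<open>j\<close> is recorded because states are extensional functions,
  and so one function can be a state of two different sets of variables.\<close>

datatype node =
    Root
  | Node "nat set" nat "nat \<Rightarrow> nat"

fun edge_label :: "(nat \<times> nat) set \<Rightarrow> nat list \<Rightarrow> node \<times> node \<Rightarrow> label" where
  "edge_label E \<pi> (Root, Node I j x) = ASym I"
| "edge_label E \<pi> (Node I j x, Node I' j' x') = cond_label E I (\<pi> ! j) x'"

definition int_tree ::
  "nat \<Rightarrow> (nat \<Rightarrow> nat) \<Rightarrow> (nat \<times> nat) set \<Rightarrow> nat set set \<Rightarrow> nat list \<Rightarrow> (node, label) ltree" where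
  "int_tree p d E \<I> \<pi> =
     \<lparr>verts = {Root} \<union> {Node I j x | I j x. I \<in> \<I> \<and> j \<le> p \<and> x \<in> states d (set (take j \<pi>))},
      arcs = {(Root, Node I 0 x) | I x. I \<in> \<I> \<and> x \<in> states d {}} \<union>
             {(Node I j x, Node I (Suc j) (x(\<pi> ! j := a))) | I j x a.
                I \<in> \<I> \<and> j < p \<and> x \<in> states d (set (take j \<pi>)) \<and> a \<in> {1..d (\<pi> ! j)}},
      lab = edge_label E \<pi>\<rparr>"


section \<open>The toric ideal and the factorization ideal\<close>

text \<open>The pair \<open>(I, x)\<close> stands for the indeterminate \<open>p\<^sup>(\<^sup>I\<^sup>)\<^sub>x\<close>.\<close>

definition indets :: "nat \<Rightarrow> (nat \<Rightarrow> nat) \<Rightarrow> nat set set \<Rightarrow> (nat set \<times> (nat \<Rightarrow> nat)) set" where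
  "indets p d \<I> = \<I> \<times> states d {1..p}"

definition toric_map ::
  "nat \<Rightarrow> (nat \<times> nat) set \<Rightarrow> (nat set \<times> (nat \<Rightarrow> nat)) mpoly \<Rightarrow> label mpoly" where
  "toric_map p E =
     mpoly_hom (\<lambda>(I, x). Var (ASym I) * (\<Prod>j\<in>{1..p}. Var (cond_label E I j x)))"

definition toric_kernel ::
  "nat \<Rightarrow> (nat \<Rightarrow> nat) \<Rightarrow> (nat \<times> nat) set \<Rightarrow> nat set set \<Rightarrow>
     (nat set \<times> (nat \<Rightarrow> nat)) mpoly set" where
  "toric_kernel p d E \<I> =
     a_kernel (mpoly_ring (indets p d \<I>)) (mpoly_ring (labels p d E \<I>)) (toric_map p E)"

definition sum_to_one ::
  "nat \<Rightarrow> (nat \<Rightarrow> nat) \<Rightarrow> (nat \<times> nat) set \<Rightarrow> nat set set \<Rightarrow> label mpoly set" where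
  "sum_to_one p d E \<I> =
     {(\<Sum>a\<in>{1..d j}. Var (FSym I j a y)) - 1 | I j y.
        I \<in> \<I> \<and> j \<in> {1..p} \<and> (I = {} \<or> j \<in> I) \<and> y \<in> states d (pa E j)}"

definition factorization_ideal ::
  "nat \<Rightarrow> (nat \<Rightarrow> nat) \<Rightarrow> (nat \<times> nat) set \<Rightarrow> nat set set \<Rightarrow>
     (nat set \<times> (nat \<Rightarrow> nat)) mpoly set" where
  "factorization_ideal p d E \<I> =
     (let R = mpoly_ring (labels p d E \<I>);
          N = genideal R (sum_to_one p d E \<I>)
      in a_kernel (mpoly_ring (indets p d \<I>)) (R Quot N) (\<lambda>q. N +>\<^bsub>R\<^esub> toric_map p E q))"

end

(* A positive real weighting s of the labels turns every interpolating polynomial t(v) into a positive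
   number. If the tree is balanced, the weights s(e) t(v') / t(v) of the edges e from v to v' depend only
   on the label of e and sum to one at every vertex, and they leave every toric monomial unchanged once
   the weight of a_I is multiplied by t(v_I). Hence a polynomial whose toric image lies in the sum-to-one
   ideal has toric image zero at every positive point. Conversely, modulo the sum-to-one relations every
   t(v) below the root is 1, so for same-stage vertices v, w the polynomial
   p[v1] p[w2] - p[w1] p[v2], where p[u] sums the indeterminates of the leaves below u, lies in the
   factorization ideal; it lies in the toric kernel only if v and w are balanced.

   For a perfect graph with ancestral targets the factors of the descendants of j can be exchanged
   between two same-stage vertices, which gives balancedness. If two parents of k are not adjacent, or
   an edge j -> k has k but not j in a target, then weighting all labels by 1 except some of those
   of k by 2 exhibits an unbalanced pair. *)

theory Submission
  imports Defs
begin

section \<open>Evaluation of polynomials\<close>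

lemma Const_add: "Const (a + b) = Const a + Const b"
  by (simp add: Const_def single_add)

lemma Const_mult: "Const (a * b) = Const a * Const b"
  by (simp add: Const_def mult_single)

lemma Const_1 [simp]: "Const 1 = 1"
  by (simp add: Const_def flip: single_one)

text \<open>Values lie in any commutative semiring, so that the same facts serve substitution of
  polynomials and evaluation at real points.\<close>

definition mon :: "('x \<Rightarrow> 'b::comm_semiring_1) \<Rightarrow> ('x \<Rightarrow>\<^sub>0 nat) \<Rightarrow> 'b" where
  "mon \<sigma> m = (\<Prod>x\<in>Poly_Mapping.keys m. \<sigma> x ^ Poly_Mapping.lookup m x)"

lemma mon_superset:
  assumes "finite A" "Poly_Mapping.keys m \<subseteq> A"
  shows "mon \<sigma> m = (\<Prod>x\<in>A. \<sigma> x ^ Poly_Mapping.lookup m x)"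
  unfolding mon_def by (rule prod.mono_neutral_left) (use assms in \<open>auto simp: in_keys_iff\<close>)

lemma mon_0 [simp]: "mon \<sigma> 0 = 1"
  by (simp add: mon_def)

lemma mon_add: "mon \<sigma> (m + n) = mon \<sigma> m * mon \<sigma> n"
proof -
  let ?A = "Poly_Mapping.keys m \<union> Poly_Mapping.keys n"
  have "mon \<sigma> (m + n) = (\<Prod>x\<in>?A. \<sigma> x ^ Poly_Mapping.lookup (m + n) x)"
    by (rule mon_superset) (use keys_add[of m n] in auto)
  also have "\<dots> = (\<Prod>x\<in>?A. \<sigma> x ^ Poly_Mapping.lookup m x) * (\<Prod>x\<in>?A. \<sigma> x ^ Poly_Mapping.lookup n x)"
    by (simp add: lookup_add power_add prod.distrib)
  also have "\<dots> = mon \<sigma> m * mon \<sigma> n"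
    by (simp add: mon_superset[of ?A])
  finally show ?thesis .
qed

lemma mon_single [simp]: "mon \<sigma> (Poly_Mapping.single x k) = \<sigma> x ^ k"
  by (simp add: mon_def)

text \<open>Coefficients are mapped by \<open>c\<close>: the choice \<open>Const\<close> gives
  substitution of polynomials for the indeterminates, the identity gives the value at a real
  point.\<close>

locale coeff_hom =
  fixes c :: "real \<Rightarrow> 'b::comm_ring_1"
  assumes c_add: "c (a + b) = c a + c b" and c_mult: "c (a * b) = c a * c b" and c_1: "c 1 = 1"
begin

lemma c_0: "c 0 = 0"
  using c_add[of 0 0] by simp

definition peval :: "('x \<Rightarrow> 'b) \<Rightarrow> 'x mpoly \<Rightarrow> 'b" where
  "peval \<sigma> q = (\<Sum>m\<in>Poly_Mapping.keys q. c (Poly_Mapping.lookup q m) * mon \<sigma> m)"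

lemma peval_superset:
  assumes "finite A" "Poly_Mapping.keys q \<subseteq> A"
  shows "peval \<sigma> q = (\<Sum>m\<in>A. c (Poly_Mapping.lookup q m) * mon \<sigma> m)"
  unfolding peval_def by (rule sum.mono_neutral_left) (use assms in \<open>auto simp: in_keys_iff c_0\<close>)

lemma peval_add [simp]: "peval \<sigma> (q + r) = peval \<sigma> q + peval \<sigma> r"
proof -
  let ?A = "Poly_Mapping.keys q \<union> Poly_Mapping.keys r"
  have "peval \<sigma> (q + r) = (\<Sum>m\<in>?A. c (Poly_Mapping.lookup (q + r) m) * mon \<sigma> m)"
    by (rule peval_superset) (use keys_add[of q r] in auto)
  also have "\<dots> = (\<Sum>m\<in>?A. c (Poly_Mapping.lookup q m) * mon \<sigma> m)
                + (\<Sum>m\<in>?A. c (Poly_Mapping.lookup r m) * mon \<sigma> m)"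
    by (simp add: lookup_add c_add ring_distribs sum.distrib)
  also have "\<dots> = peval \<sigma> q + peval \<sigma> r"
    by (simp add: peval_superset[of ?A])
  finally show ?thesis .
qed

lemma peval_0 [simp]: "peval \<sigma> 0 = 0"
  by (simp add: peval_def)

lemma peval_single: "peval \<sigma> (Poly_Mapping.single m a) = c a * mon \<sigma> m"
  by (simp add: peval_def c_0)

lemma peval_1 [simp]: "peval \<sigma> 1 = 1"
  using peval_single[of \<sigma> 0 1] by (simp add: c_1)

lemma peval_Var [simp]: "peval \<sigma> (Var x) = \<sigma> x"
  by (simp add: Var_def peval_single c_1)

lemma peval_Const [simp]: "peval \<sigma> (Const a) = c a"
  by (simp add: Const_def peval_single)

lemma peval_sum [simp]: "peval \<sigma> (\<Sum>i\<in>A. f i) = (\<Sum>i\<in>A. peval \<sigma> (f i))"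
  by (induction A rule: infinite_finite_induct) auto

lemma peval_minus [simp]: "peval \<sigma> (q - r) = peval \<sigma> q - peval \<sigma> r"
  by (metis add_diff_cancel_right' diff_add_cancel peval_add)

lemma peval_mult [simp]: "peval \<sigma> (q * r) = peval \<sigma> q * peval \<sigma> r"
proof -
  have decompose: "q = (\<Sum>m\<in>Poly_Mapping.keys q. Poly_Mapping.single m (Poly_Mapping.lookup q m))"
    for q :: "'x mpoly"
    by (rule poly_mapping_eqI) (simp add: lookup_sum lookup_single when_def in_keys_iff)
  have "peval \<sigma> (q * r) =
    peval \<sigma> ((\<Sum>m\<in>Poly_Mapping.keys q. Poly_Mapping.single m (Poly_Mapping.lookup q m)) *
            (\<Sum>n\<in>Poly_Mapping.keys r. Poly_Mapping.single n (Poly_Mapping.lookup r n)))"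
    by (simp flip: decompose)
  also have "\<dots> = (\<Sum>m\<in>Poly_Mapping.keys q. \<Sum>n\<in>Poly_Mapping.keys r.
      (c (Poly_Mapping.lookup q m) * mon \<sigma> m) * (c (Poly_Mapping.lookup r n) * mon \<sigma> n))"
    by (simp add: sum_product mult_single peval_single c_mult mon_add mult_ac)
  also have "\<dots> = peval \<sigma> q * peval \<sigma> r"
    by (simp add: peval_def sum_product)
  finally show ?thesis .
qed

lemma peval_prod [simp]: "peval \<sigma> (\<Prod>i\<in>A. f i) = (\<Prod>i\<in>A. peval \<sigma> (f i))"
  by (induction A rule: infinite_finite_induct) auto

lemma peval_power [simp]: "peval \<sigma> (q ^ n) = peval \<sigma> q ^ n"
  by (induction n) auto

end

section \<open>Substitution, evaluation and independence of monomials\<close>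

interpretation poly: coeff_hom Const
  by unfold_locales (auto simp: Const_add Const_mult)

interpretation real: coeff_hom "\<lambda>a::real. a"
  by unfold_locales auto

lemma mpoly_hom_eq_peval: "mpoly_hom = poly.peval"
  by (simp add: mpoly_hom_def poly.peval_def mon_def fun_eq_iff)

text \<open>Turns a statement about the toric image at a point into one about the images of the
  single indeterminates at that point.\<close>

lemma real_peval_hom: "real.peval s (mpoly_hom \<sigma> q) = real.peval (\<lambda>x. real.peval s (\<sigma> x)) q"
  by (simp add: mpoly_hom_def) (simp add: real.peval_def mon_def)

text \<open>Distinct monomials are distinct characters of the group of positive points, so
  Dedekind's argument applies: doubling one coordinate that separates two monomials
  eliminates one of them.\<close>

lemma mon_independent:
  fixes a :: "('x \<Rightarrow>\<^sub>0 nat) \<Rightarrow> real"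
  assumes "finite K" "\<And>s. (\<And>x. 0 < s x) \<Longrightarrow> (\<Sum>m\<in>K. a m * mon s m) = 0" "m \<in> K"
  shows "a m = 0"
  using assms
proof (induction K arbitrary: a m rule: finite_induct)
  case empty
  then show ?case by simp
next
  case (insert n K)
  have rest: "a m = 0" if "m \<in> K" for m
  proof -
    from that insert have "m \<noteq> n" by auto
    then obtain x where x: "Poly_Mapping.lookup m x \<noteq> Poly_Mapping.lookup n x"
      by (meson poly_mapping_eqI)
    \<comment> \<open>Doubling the coordinate \<open>x\<close> multiplies each monomial
      \<open>k\<close> by \<open>e k\<close>, and \<open>e m\<close> differs from \<open>e n\<close>
      by the choice of \<open>x\<close>.\<close>
    define e where "e k = (2::real) ^ Poly_Mapping.lookup k x" for k :: "'x \<Rightarrow>\<^sub>0 nat"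
    have dbl: "mon (s(x := 2 * s x)) k = e k * mon s k" for s :: "'x \<Rightarrow> real" and k
    proof -
      let ?A = "insert x (Poly_Mapping.keys k)"
      have "mon (s(x := 2 * s x)) k = (\<Prod>y\<in>?A. (if y = x then e k else 1) * s y ^ Poly_Mapping.lookup k y)"
        unfolding mon_superset[of ?A, OF finite.insertI[OF finite_keys] subset_insertI]
        by (rule prod.cong) (auto simp: e_def power_mult_distrib)
      also have "\<dots> = e k * mon s k"
        unfolding mon_superset[of ?A, OF finite.insertI[OF finite_keys] subset_insertI] prod.distrib
        by (simp add: prod.delta')
      finally show ?thesis .
    qed
    \<comment> \<open>The relation at the doubled point minus \<open>e n\<close> times the original
      one has no term for \<open>n\<close>, so the induction hypothesis applies to its
      coefficients.\<close>
    have "(e m - e n) * a m = 0"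
    proof (rule insert.IH[of "\<lambda>k. (e k - e n) * a k", OF _ that])
      fix s :: "'x \<Rightarrow> real" assume s: "\<And>x. 0 < s x"
      have "(\<Sum>k\<in>insert n K. a k * mon (s(x := 2 * s x)) k) = 0"
        by (rule insert.prems(1)) (use s in auto)
      then have "(\<Sum>k\<in>insert n K. a k * (e k * mon s k)) = 0"
        by (simp only: dbl)
      moreover have "(\<Sum>k\<in>insert n K. e n * (a k * mon s k)) = 0"
        using insert.prems(1)[OF s] by (simp flip: sum_distrib_left)
      ultimately have "(\<Sum>k\<in>insert n K. (e k - e n) * a k * mon s k) = 0"
        by (simp add: algebra_simps sum_subtractf)
      then show "(\<Sum>k\<in>K. (e k - e n) * a k * mon s k) = 0"
        using insert.hyps by simp
    qed
    then show ?thesis using x by (simp add: e_def)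
  qed
  \<comment> \<open>With all other coefficients zero, the point with all coordinates 1 yields the
    coefficient of \<open>n\<close>.\<close>
  have "(\<Sum>k\<in>insert n K. a k * mon (\<lambda>_. 1) k) = 0"
    by (rule insert.prems(1)) simp
  moreover have "(\<Sum>k\<in>K. a k * mon (\<lambda>_. 1) k) = 0"
    by (rule sum.neutral) (simp add: rest)
  ultimately have "a n = 0" using insert.hyps by (simp add: mon_def)
  then show ?case using rest insert.prems(2) by auto
qed

text \<open>Every coefficient vanishes by \<open>mon_independent\<close>. Only positive points are
  tested, because the reweighting below divides by values of interpolating polynomials.\<close>

lemma mpoly_eq_0_if_vanishes:
  fixes q :: "'x mpoly"
  assumes "\<And>s. (\<And>x. 0 < s x) \<Longrightarrow> real.peval s q = 0"
  shows "q = 0"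
proof (rule poly_mapping_eqI)
  fix m
  show "Poly_Mapping.lookup q m = Poly_Mapping.lookup 0 m"
  proof (cases "m \<in> Poly_Mapping.keys q")
    case True
    then show ?thesis
      using mon_independent[of "Poly_Mapping.keys q" "Poly_Mapping.lookup q"] assms
      by (simp add: real.peval_def)
  qed (simp add: in_keys_iff)
qed

section \<open>Interpolating polynomials\<close>

lemma paths_to_leaves_leaf:
  assumes "v \<in> leaves T"
  shows "paths_to_leaves T v = {[v]}"
proof (intro equalityI subsetI)
  fix vs assume vs: "vs \<in> paths_to_leaves T v"
  then obtain us where us: "vs = v # us"
    by (cases vs) (auto simp: paths_to_leaves_def)
  have "us = []"
    using vs assms by (cases us) (auto simp: us paths_to_leaves_def leaves_def)
  then show "vs \<in> {[v]}" by (simp add: us)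
qed (use assms in \<open>auto simp: paths_to_leaves_def\<close>)

lemma paths_to_leaves_step:
  assumes "v \<notin> leaves T"
  shows "paths_to_leaves T v = (\<Union>w\<in>arcs T `` {v}. (#) v ` paths_to_leaves T w)"
proof (intro equalityI subsetI)
  fix vs assume vs: "vs \<in> paths_to_leaves T v"
  then obtain us where us: "vs = v # us"
    by (cases vs) (auto simp: paths_to_leaves_def)
  with vs assms obtain w ws where "us = w # ws"
    by (cases us) (auto simp: paths_to_leaves_def)
  with vs show "vs \<in> (\<Union>w\<in>arcs T `` {v}. (#) v ` paths_to_leaves T w)"
    by (auto simp: us paths_to_leaves_def intro!: bexI[of _ w] imageI)
next
  fix vs assume "vs \<in> (\<Union>w\<in>arcs T `` {v}. (#) v ` paths_to_leaves T w)"
  then show "vs \<in> paths_to_leaves T v"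
    by (auto simp: paths_to_leaves_def neq_Nil_conv)
qed

lemma path_weight_Cons:
  "us \<noteq> [] \<Longrightarrow> path_weight T (v # us) = Var (lab T (v, hd us)) * path_weight T us"
  by (cases us) (auto simp: path_weight_def)

text \<open>Paths are sorted by their first arc, and those through different children are disjoint.
  Finiteness is assumed because a sum over an infinite set is 0 by convention.\<close>

lemma interp_poly_step:
  assumes "v \<notin> leaves T" "finite (arcs T `` {v})"
    and "\<And>w. (v, w) \<in> arcs T \<Longrightarrow> finite (paths_to_leaves T w)"
  shows "interp_poly T v = (\<Sum>w\<in>arcs T `` {v}. Var (lab T (v, w)) * interp_poly T w)"
proof -
  have "interp_poly T v =
      (\<Sum>w\<in>arcs T `` {v}. \<Sum>vs\<in>(#) v ` paths_to_leaves T w. path_weight T vs)"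
    unfolding interp_poly_def paths_to_leaves_step[OF assms(1)]
    by (rule sum.UNION_disjoint) (use assms in \<open>auto simp: paths_to_leaves_def\<close>)
  also have "\<dots> = (\<Sum>w\<in>arcs T `` {v}. Var (lab T (v, w)) * interp_poly T w)"
  proof (rule sum.cong)
    fix w
    have "(\<Sum>vs\<in>(#) v ` paths_to_leaves T w. path_weight T vs) =
        (\<Sum>us\<in>paths_to_leaves T w. path_weight T (v # us))"
      by (subst sum.reindex) auto
    also have "\<dots> = (\<Sum>us\<in>paths_to_leaves T w. Var (lab T (v, w)) * path_weight T us)"
      by (rule sum.cong) (auto simp: paths_to_leaves_def path_weight_Cons)
    finally show "(\<Sum>vs\<in>(#) v ` paths_to_leaves T w. path_weight T vs) =
        Var (lab T (v, w)) * interp_poly T w"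
      by (simp add: interp_poly_def sum_distrib_left)
  qed simp
  finally show ?thesis .
qed

text \<open>The interpolating polynomial as an iterated sum: \<open>x\<close> is the state reached
  and \<open>ks\<close> lists the variables still to be read. Weights lie in any commutative
  semiring, so that evaluated sums have the same form.\<close>

fun tree_sum ::
  "(nat \<Rightarrow> nat) \<Rightarrow> (nat \<Rightarrow> (nat \<Rightarrow> nat) \<Rightarrow> 'a::comm_semiring_1) \<Rightarrow> nat list \<Rightarrow> (nat \<Rightarrow> nat) \<Rightarrow> 'a"
where
  "tree_sum d w [] x = 1"
| "tree_sum d w (k # ks) x =
     (\<Sum>a\<in>{1..d k}. w k (x(k := a)) * tree_sum d w ks (x(k := a)))"

lemma (in coeff_hom) peval_tree_sum:
  "peval s (tree_sum d w ks x) = tree_sum d (\<lambda>k x. peval s (w k x)) ks x"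
  by (induction ks arbitrary: x) auto

lemma tree_sum_pos:
  fixes w :: "nat \<Rightarrow> (nat \<Rightarrow> nat) \<Rightarrow> real"
  assumes "\<And>k x. 0 < w k x" "\<And>k. k \<in> set ks \<Longrightarrow> 0 < d k"
  shows "0 < tree_sum d w ks x"
  using assms(2)
proof (induction ks arbitrary: x)
  case (Cons k ks)
  then show ?case
    by (auto intro!: sum_pos mult_pos_pos assms(1) simp: Suc_le_eq)
qed simp

text \<open>The superscript of the symbol for variable \<open>k\<close> in the copy of the tree that
  belongs to \<open>I\<close>.\<close>

definition target :: "nat set \<Rightarrow> nat \<Rightarrow> nat set" where
  "target I k = (if k \<in> I then I else {})"

section \<open>Nodes, arcs and labels of the interventional tree\<close>

locale int_tree_setup =
  fixes p :: nat and d :: "nat \<Rightarrow> nat" and E :: "(nat \<times> nat) set"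
    and \<I> :: "nat set set" and \<pi> :: "nat list"
  assumes dag: "dag p E"
    and d_ge_2: "\<forall>k\<in>{1..p}. 2 \<le> d k"
    and empty_target: "{} \<in> \<I>"
    and ext: "linear_extension p E \<pi>"
begin

abbreviation T where "T \<equiv> int_tree p d E \<I> \<pi>"

abbreviation S where "S n \<equiv> states d (set (take n \<pi>))"

lemma set_\<pi>: "set \<pi> = {1..p}" and distinct_\<pi>: "distinct \<pi>"
  using ext by (auto simp: linear_extension_def)

lemma length_\<pi> [simp]: "length \<pi> = p"
  using distinct_card[OF distinct_\<pi>] by (simp add: set_\<pi>)

lemma nth_\<pi>: "n < p \<Longrightarrow> \<pi> ! n \<in> {1..p}"
  using nth_mem[of n \<pi>] by (simp add: set_\<pi>)

lemma d_pos: "k \<in> {1..p} \<Longrightarrow> 0 < d k"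
  using d_ge_2 by fastforce

lemma position:
  assumes "k \<in> {1..p}"
  obtains n where "n < p" "k = \<pi> ! n"
  using assms by (metis in_set_conv_nth length_\<pi> set_\<pi>)

lemma edge_position:
  assumes "(\<pi> ! m, \<pi> ! n) \<in> E" "m < p" "n < p"
  shows "m < n"
  using assms ext by (auto simp: linear_extension_def)

lemma pa_subset: "pa E k \<subseteq> {1..p}"
  using dag by (auto simp: dag_def pa_def)

lemma pa_before:
  assumes "n < p"
  shows "pa E (\<pi> ! n) \<subseteq> set (take n \<pi>)"
proof
  fix i assume i: "i \<in> pa E (\<pi> ! n)"
  then obtain m where m: "m < p" "i = \<pi> ! m"
    using pa_subset position by blast
  with i assms have "m < n" by (auto simp: pa_def intro: edge_position)
  then show "i \<in> set (take n \<pi>)"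
    using m assms by (auto simp: in_set_conv_nth intro!: exI[of _ m])
qed

lemma not_in_pa [simp]: "k \<notin> pa E k"
  using dag by (auto simp: dag_def pa_def acyclic_def)

lemma set_take_Suc: "n < p \<Longrightarrow> set (take (Suc n) \<pi>) = insert (\<pi> ! n) (set (take n \<pi>))"
  by (simp add: take_Suc_conv_app_nth)

lemma nth_notin_take: "n < p \<Longrightarrow> \<pi> ! n \<notin> set (take n \<pi>)"
  using distinct_\<pi> by (auto simp: in_set_conv_nth nth_eq_iff_index_eq)

lemma drop_\<pi>: "n < p \<Longrightarrow> drop n \<pi> = \<pi> ! n # drop (Suc n) \<pi>"
  by (simp add: Cons_nth_drop_Suc)

lemma states_update:
  "n < p \<Longrightarrow> x \<in> S n \<Longrightarrow> a \<in> {1..d (\<pi> ! n)} \<Longrightarrow> x(\<pi> ! n := a) \<in> S (Suc n)"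
  unfolding set_take_Suc states_def by (rule PiE_fun_upd) auto

lemma cond_label_update:
  "cond_label E I k (x(k := a)) = FSym (target I k) k a (restrict x (pa E k))"
  by (auto simp: cond_label_def target_def)

lemma cond_label_cong:
  assumes "x k = x' k" "\<And>i. i \<in> pa E k \<Longrightarrow> x i = x' i" "target I k = target J k"
  shows "cond_label E I k x = cond_label E J k x'"
  using assms by (auto simp: cond_label_def target_def restrict_def)

lemma arcs_Root: "(Root, w) \<in> arcs T \<longleftrightarrow> (\<exists>I\<in>\<I>. w = Node I 0 (\<lambda>_. undefined))"
  by (auto simp: int_tree_def states_def)

lemma arcs_Node:
  "(Node I n x, w) \<in> arcs T \<longleftrightarrow> I \<in> \<I> \<and> n < p \<and> x \<in> S n \<and>
     (\<exists>a\<in>{1..d (\<pi> ! n)}. w = Node I (Suc n) (x(\<pi> ! n := a)))"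
  by (auto simp: int_tree_def)

lemma children_Node:
  assumes "I \<in> \<I>" "n < p" "x \<in> S n"
  shows "arcs T `` {Node I n x} = (\<lambda>a. Node I (Suc n) (x(\<pi> ! n := a))) ` {1..d (\<pi> ! n)}"
  using assms unfolding Image_singleton arcs_Node by blast

lemma lab_Root: "lab T (Root, Node I n x) = ASym I"
  by (simp add: int_tree_def)

lemma lab_Node:
  "lab T (Node I n x, Node J m (x(\<pi> ! n := a))) =
     FSym (target I (\<pi> ! n)) (\<pi> ! n) a (restrict x (pa E (\<pi> ! n)))"
  by (simp add: int_tree_def cond_label_update)

text \<open>The polynomial t(v) of v = \<open>Node I n x\<close> in a form that permits induction on
  the depth without mentioning paths.\<close>

definition tpoly :: "nat set \<Rightarrow> nat \<Rightarrow> (nat \<Rightarrow> nat) \<Rightarrow> label mpoly" where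
  "tpoly I n x = tree_sum d (\<lambda>k x. Var (cond_label E I k x)) (drop n \<pi>) x"

text \<open>Downward induction from the leaves. Finiteness of the path sets is carried along since
  \<open>interp_poly_step\<close> asks for it at the children.\<close>

lemma interp_poly_Node:
  assumes "n \<le> p" "I \<in> \<I>" "x \<in> S n"
  shows "finite (paths_to_leaves T (Node I n x)) \<and> interp_poly T (Node I n x) = tpoly I n x"
  using assms(1,3)
proof (induction n arbitrary: x rule: inc_induct)
  case base
  then have "Node I p x \<in> leaves T"
    using assms(2) by (auto simp: leaves_def arcs_Node int_tree_def)
  then show ?case
    by (simp add: paths_to_leaves_leaf interp_poly_def path_weight_def tpoly_def)
next
  case (step n)
  let ?k = "\<pi> ! n"
  have n: "n < p" using step by simp
  note children = children_Node[OF assms(2) n step.prems]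
  have IH: "finite (paths_to_leaves T (Node I (Suc n) (x(?k := a))))"
    "interp_poly T (Node I (Suc n) (x(?k := a))) = tpoly I (Suc n) (x(?k := a))"
    if "a \<in> {1..d ?k}" for a
    using step.IH[OF states_update[OF n step.prems that]] by (rule conjunct1, rule conjunct2)
  have "1 \<in> {1..d ?k}" using d_pos[OF nth_\<pi>[OF n]] by simp
  with children have nonleaf: "Node I n x \<notin> leaves T"
    by (auto simp: leaves_def)
  have fin: "finite (paths_to_leaves T w)" if "(Node I n x, w) \<in> arcs T" for w
    using that IH(1) by (auto simp: arcs_Node)
  have "interp_poly T (Node I n x) =
      (\<Sum>w\<in>arcs T `` {Node I n x}. Var (lab T (Node I n x, w)) * interp_poly T w)"
    by (rule interp_poly_step[OF nonleaf _ fin]) (simp_all add: children)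
  also have "\<dots> = (\<Sum>a\<in>{1..d ?k}. Var (cond_label E I ?k (x(?k := a))) * tpoly I (Suc n) (x(?k := a)))"
    unfolding children
  proof (subst sum.reindex)
    show "inj_on (\<lambda>a. Node I (Suc n) (x(?k := a))) {1..d ?k}"
      by (rule inj_onI) (metis fun_upd_same node.inject)
  qed (simp add: lab_Node cond_label_update IH(2))
  also have "\<dots> = tpoly I n x"
    by (simp add: tpoly_def drop_\<pi>[OF n])
  finally have "interp_poly T (Node I n x) = tpoly I n x" .
  moreover have "finite (paths_to_leaves T (Node I n x))"
    unfolding paths_to_leaves_step[OF nonleaf] using children fin by auto
  ultimately show ?case by simp
qed

lemma interp_poly_child:
  assumes "n < p" "I \<in> \<I>" "x \<in> S n" "a \<in> {1..d (\<pi> ! n)}"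
  shows "interp_poly T (Node I (Suc n) (x(\<pi> ! n := a))) = tpoly I (Suc n) (x(\<pi> ! n := a))"
  using interp_poly_Node[of "Suc n" I] states_update assms by auto

section \<open>Balancedness in terms of states\<close>

lemma same_stage_Node:
  assumes "n < p" "I \<in> \<I>" "J \<in> \<I>" "x \<in> S n" "x' \<in> S n"
    and "target I (\<pi> ! n) = target J (\<pi> ! n)"
    and "restrict x (pa E (\<pi> ! n)) = restrict x' (pa E (\<pi> ! n))"
  shows "same_stage T (Node I n x) (Node J n x')"
proof -
  have "lab T ` {e \<in> arcs T. fst e = Node I n x} =
      (\<lambda>a. FSym (target I (\<pi> ! n)) (\<pi> ! n) a (restrict x (pa E (\<pi> ! n)))) ` {1..d (\<pi> ! n)}"
    if "I \<in> \<I>" "x \<in> S n" for I x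
  proof -
    have "{e \<in> arcs T. fst e = Node I n x} = Pair (Node I n x) ` (arcs T `` {Node I n x})"
      by force
    then show ?thesis
      by (simp add: children_Node that assms(1) image_image lab_Node)
  qed
  then show ?thesis using assms by (simp add: same_stage_def)
qed

text \<open>Children are indexed by their values \<open>a\<close> and \<open>b\<close>; the case
  \<open>a = b\<close> holds by commutativity. Both nodes have the same depth, because a label
  records its variable. The root does not occur: its labels determine its children, so comparing it
  with itself is trivial.\<close>

definition tree_balanced :: bool where
  "tree_balanced \<longleftrightarrow> (\<forall>n<p. \<forall>I\<in>\<I>. \<forall>J\<in>\<I>. \<forall>x\<in>S n. \<forall>x'\<in>S n.
     \<forall>a\<in>{1..d (\<pi> ! n)}. \<forall>b\<in>{1..d (\<pi> ! n)}.
       target I (\<pi> ! n) = target J (\<pi> ! n) \<longrightarrow>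
       restrict x (pa E (\<pi> ! n)) = restrict x' (pa E (\<pi> ! n)) \<longrightarrow>
       tpoly I (Suc n) (x(\<pi> ! n := a)) * tpoly J (Suc n) (x'(\<pi> ! n := b)) =
       tpoly J (Suc n) (x'(\<pi> ! n := a)) * tpoly I (Suc n) (x(\<pi> ! n := b)))"

lemma balanced_iff: "balanced T \<longleftrightarrow> tree_balanced"
proof
  assume bal: "balanced T"
  show tree_balanced
    unfolding tree_balanced_def
  proof (intro allI ballI impI)
    fix n I J x x' a b
    let ?k = "\<pi> ! n"
    assume *: "n < p" "I \<in> \<I>" "J \<in> \<I>" "x \<in> S n" "x' \<in> S n" "a \<in> {1..d ?k}" "b \<in> {1..d ?k}"
      "target I ?k = target J ?k" "restrict x (pa E ?k) = restrict x' (pa E ?k)"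
    have "Node I n x \<in> verts T" "Node J n x' \<in> verts T"
      using * by (auto simp: int_tree_def)
    with bal same_stage_Node have bp: "balanced_pair T (Node I n x) (Node J n x')"
      using * unfolding balanced_def by blast
    show "tpoly I (Suc n) (x(?k := a)) * tpoly J (Suc n) (x'(?k := b)) =
        tpoly J (Suc n) (x'(?k := a)) * tpoly I (Suc n) (x(?k := b))"
    proof (cases "a = b")
      case False
      then have "x(?k := a) \<noteq> x(?k := b)" by (metis fun_upd_same)
      then have "interp_poly T (Node I (Suc n) (x(?k := a))) * interp_poly T (Node J (Suc n) (x'(?k := b))) =
          interp_poly T (Node J (Suc n) (x'(?k := a))) * interp_poly T (Node I (Suc n) (x(?k := b)))"
        using * by (intro bp[unfolded balanced_pair_def, rule_format]) (auto simp: arcs_Node lab_Node)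
      then show ?thesis using * by (simp add: interp_poly_child)
    qed (simp add: mult.commute)
  qed
next
  assume bal: tree_balanced
  \<comment> \<open>Arcs with a common label leave nodes of the same kind, with equal depth,
    superscript and parent state; these are the premises in \<open>tree_balanced\<close>.\<close>
  have "balanced_pair T v w" for v w
    unfolding balanced_pair_def
  proof (intro allI impI, elim conjE)
    fix v1 v2 w1 w2
    assume *: "(v, v1) \<in> arcs T" "(v, v2) \<in> arcs T" "(w, w1) \<in> arcs T" "(w, w2) \<in> arcs T"
      "lab T (v, v1) = lab T (w, w1)" "lab T (v, v2) = lab T (w, w2)"
    show "interp_poly T v1 * interp_poly T w2 = interp_poly T w1 * interp_poly T v2"
    proof (cases v)
      \<comment> \<open>The labels \<open>ASym\<close> leave only the root and determine the child,
        so \<open>v1 = w1\<close> and \<open>v2 = w2\<close>.\<close>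
      case Root
      with * have "w = Root" by (cases w) (auto simp: arcs_Root arcs_Node lab_Root lab_Node)
      with Root * show ?thesis by (auto simp: arcs_Root lab_Root)
    next
      case (Node I n x)
      with * obtain J m x' where w: "w = Node J m x'"
        by (cases w) (auto simp: arcs_Root arcs_Node lab_Root lab_Node)
      obtain a b where v: "I \<in> \<I>" "n < p" "x \<in> S n" "a \<in> {1..d (\<pi> ! n)}" "b \<in> {1..d (\<pi> ! n)}"
        "v1 = Node I (Suc n) (x(\<pi> ! n := a))" "v2 = Node I (Suc n) (x(\<pi> ! n := b))"
        using * by (auto simp: Node arcs_Node)
      obtain a' b' where w': "J \<in> \<I>" "m < p" "x' \<in> S m" "a' \<in> {1..d (\<pi> ! m)}" "b' \<in> {1..d (\<pi> ! m)}"
        "w1 = Node J (Suc m) (x'(\<pi> ! m := a'))" "w2 = Node J (Suc m) (x'(\<pi> ! m := b'))"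
        using * by (auto simp: w arcs_Node)
      have l: "\<pi> ! n = \<pi> ! m" "target I (\<pi> ! n) = target J (\<pi> ! m)" "a' = a" "b' = b"
        "restrict x (pa E (\<pi> ! n)) = restrict x' (pa E (\<pi> ! m))"
        using *(5,6) unfolding Node v(6,7) w w'(6,7) lab_Node by auto
      then have "n = m"
        using distinct_\<pi> v(2) w'(2) by (simp add: nth_eq_iff_index_eq)
      then show ?thesis
        using bal v w' l unfolding tree_balanced_def
        by (simp add: interp_poly_child)
    qed
  qed
  then show "balanced T" by (simp add: balanced_def)
qed

end

section \<open>Balancedness and perfect graphs\<close>

text \<open>Neither 1 nor \<open>h\<close> changes with a variable of \<open>ks\<close>, so each of
  the iterated sums contributes only the number \<open>d l\<close> of its terms.\<close>

lemma tree_sum_single_factor: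
  fixes h :: "(nat \<Rightarrow> nat) \<Rightarrow> 'a::comm_semiring_1"
  assumes "distinct ks" "\<And>l a x. l \<in> set ks \<Longrightarrow> h (x(l := a)) = h x"
  shows "tree_sum d (\<lambda>l x. if l = k then h x else 1) ks x =
    (\<Prod>l\<in>set ks. of_nat (d l)) * (if k \<in> set ks then h x else 1)"
  using assms
proof (induction ks arbitrary: x)
  case (Cons l ks)
  have IH: "tree_sum d (\<lambda>l x. if l = k then h x else 1) ks y =
      (\<Prod>l\<in>set ks. of_nat (d l)) * (if k \<in> set ks then h y else 1)" for y
    using Cons.prems by (intro Cons.IH) auto
  have h: "h (x(l := a)) = h x" for a
    by (rule Cons.prems(2)) simp
  show ?case
    using Cons.prems(1) IH h by (cases "k = l") (auto simp: mult_ac simp del: fun_upd_apply)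
qed simp

section \<open>Ancestral targets and descendants in perfect graphs\<close>

context int_tree_setup
begin

definition ancestral :: bool where
  "ancestral \<longleftrightarrow> (\<forall>I\<in>\<I>. \<forall>i k. (i, k) \<in> E \<longrightarrow> k \<in> I \<longrightarrow> i \<in> I)"

lemma ancestral_trancl:
  assumes ancestral "I \<in> \<I>" "(i, k) \<in> E\<^sup>+" "k \<in> I"
  shows "i \<in> I"
  using assms(3,4) by (induction rule: trancl_induct) (use assms(1,2) in \<open>auto simp: ancestral_def\<close>)

text \<open>The choice \<open>J = {}\<close> reduces unions to single targets. Conversely, closure
  under parents extends along directed paths and passes to unions.\<close>

lemma ancestral_iff:
  "(\<forall>I\<in>\<I>. \<forall>J\<in>\<I>. I \<union> J = an_closure E (I \<union> J)) \<longleftrightarrow> ancestral"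
proof
  assume *: "\<forall>I\<in>\<I>. \<forall>J\<in>\<I>. I \<union> J = an_closure E (I \<union> J)"
  show ancestral
    unfolding ancestral_def
  proof (intro ballI allI impI)
    fix I i k assume "I \<in> \<I>" "(i, k) \<in> E" "k \<in> I"
    then have "i \<in> an_closure E I" "I = an_closure E I"
      using * empty_target by (fastforce simp: an_closure_def)+
    then show "i \<in> I" by simp
  qed
next
  assume ancestral
  then show "\<forall>I\<in>\<I>. \<forall>J\<in>\<I>. I \<union> J = an_closure E (I \<union> J)"
    unfolding an_closure_def using ancestral_trancl by blast
qed

definition desc :: "nat \<Rightarrow> nat set" where
  "desc j = {k. (j, k) \<in> E\<^sup>+}"

text \<open>Induction along a directed path from \<open>j\<close>, with last edge from
  \<open>k\<close> to \<open>l\<close>. In a perfect graph a parent of \<open>l\<close> other than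
  \<open>k\<close> is adjacent to \<open>k\<close>: either it is a child of \<open>k\<close> and
  descends from \<open>j\<close>, or it is a parent of \<open>k\<close>, where the induction
  hypothesis applies.\<close>

lemma pa_desc:
  assumes "perfect p E" "k \<in> desc j"
  shows "pa E k \<subseteq> insert j (desc j) \<union> pa E j"
proof -
  have adjacent: "(i, j) \<in> E \<or> (j, i) \<in> E \<or> i = j" if "(i, k) \<in> E" "(j, k) \<in> E" for i j k
  proof -
    from that have "k \<in> {1..p}" using dag by (auto simp: dag_def)
    with that assms(1) show ?thesis unfolding perfect_def pa_def mem_Collect_eq by blast
  qed
  from assms(2) have "(j, k) \<in> E\<^sup>+" by (simp add: desc_def)
  then show ?thesis
  proof (induction rule: trancl_induct)
    case (base k)
    then show ?case using adjacent by (fastforce simp: desc_def pa_def)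
  next
    case (step k l)
    show ?case
    proof
      fix i assume "i \<in> pa E l"
      then consider "(i, k) \<in> E" | "(k, i) \<in> E" | "i = k"
        using adjacent[of i l k] step.hyps by (auto simp: pa_def)
      then show "i \<in> insert j (desc j) \<union> pa E j"
      proof cases
        case 1
        then show ?thesis using step.IH by (auto simp: pa_def)
      qed (use step.hyps in \<open>auto simp: desc_def\<close>)
    qed
  qed
qed

text \<open>A target containing \<open>k\<close> contains its ancestor \<open>j\<close>. Its
  superscript at \<open>j\<close> is then the whole target, so equality at \<open>j\<close> makes
  the other target the same set. If neither contains \<open>k\<close>, both superscripts are
  empty.\<close>

lemma target_desc:
  assumes ancestral "I \<in> \<I>" "J \<in> \<I>" "target I j = target J j" "k \<in> desc j"
  shows "target I k = target J k"
proof -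
  have "j \<in> I" if "k \<in> I" "I \<in> \<I>" for I
    using ancestral_trancl[OF assms(1) that(2) _ that(1)] assms(5) by (auto simp: desc_def)
  then show ?thesis
    using assms(2-4) by (auto simp: target_def split: if_splits)
qed

text \<open>The factors of the descendants of \<open>j\<close> involve only \<open>j\<close>, its descendants and its parents,
  whereas the other factors involve neither \<open>j\<close> nor its descendants.\<close>

lemma tree_sum_exchange:
  fixes I J :: "nat set"
  defines "w \<equiv> \<lambda>I k x. Var (cond_label E I k x)"
  assumes perf: "perfect p E" and tgt: "\<And>k. k \<in> desc j \<Longrightarrow> target I k = target J k"
    and "\<And>k. k \<in> set ks \<Longrightarrow> k \<noteq> j \<and> k \<notin> pa E j"
    and "\<And>i. i \<notin> insert j (desc j) \<Longrightarrow> x i = y i"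
    and "\<And>i. i \<notin> insert j (desc j) \<Longrightarrow> x' i = y' i"
    and "\<And>i. i \<in> insert j (desc j) \<union> pa E j \<Longrightarrow> x i = x' i"
    and "\<And>i. i \<in> insert j (desc j) \<union> pa E j \<Longrightarrow> y i = y' i"
  shows "tree_sum d (w I) ks x * tree_sum d (w J) ks y' =
         tree_sum d (w I) ks y * tree_sum d (w J) ks x'"
  using assms(4-)
proof (induction ks arbitrary: x y x' y')
  case (Cons k ks)
  let ?U = "insert j (desc j)" and ?t = "\<lambda>I. tree_sum d (w I) ks"
  have k: "k \<noteq> j" "k \<notin> pa E j" using Cons.prems(1) by auto
  show ?case
  proof (cases "k \<in> desc j")
    \<comment> \<open>A descendant has the same factor for \<open>x\<close> and \<open>x'\<close>,
      and for \<open>y\<close> and \<open>y'\<close>. The value \<open>a\<close> is read in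
      \<open>x\<close> and \<open>x'\<close>, the value \<open>b\<close> in \<open>y\<close> and
      \<open>y'\<close>, which keeps both pairs equal at \<open>k\<close>.\<close>
    case True
    then have pa: "pa E k \<subseteq> ?U \<union> pa E j" using pa_desc[OF perf] by blast
    have f: "w I k (x(k := a)) = w J k (x'(k := a))" "w J k (y'(k := a)) = w I k (y(k := a))" for a
      using pa Cons.prems(4,5) tgt[OF True] unfolding w_def
      by (auto intro!: arg_cong[of _ _ Var] cond_label_cong simp: subset_iff)
    have IH: "?t I (x(k := a)) * ?t J (y'(k := b)) = ?t I (y(k := b)) * ?t J (x'(k := a))" for a b
      by (rule Cons.IH) (use Cons.prems True in auto)
    have "tree_sum d (w I) (k # ks) x * tree_sum d (w J) (k # ks) y' =
        (\<Sum>a\<in>{1..d k}. \<Sum>b\<in>{1..d k}. w I k (x(k := a)) * w J k (y'(k := b)) *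
          (?t I (x(k := a)) * ?t J (y'(k := b))))"
      by (simp add: sum_product mult_ac)
    also have "\<dots> = (\<Sum>a\<in>{1..d k}. \<Sum>b\<in>{1..d k}. w J k (x'(k := a)) * w I k (y(k := b)) *
          (?t I (y(k := b)) * ?t J (x'(k := a))))"
      by (simp only: f IH)
    also have "\<dots> = tree_sum d (w J) (k # ks) x' * tree_sum d (w I) (k # ks) y"
      unfolding tree_sum.simps sum_product by (intro sum.cong refl) (simp add: mult_ac)
    finally show ?thesis by (simp only: mult.commute)
  next
    \<comment> \<open>A parent of \<open>k\<close> in \<open>?U\<close> would make \<open>k\<close>
      a descendant, so the factor of \<open>k\<close> is the same for \<open>x\<close> and
      \<open>y\<close>, and for \<open>x'\<close> and \<open>y'\<close>. Now \<open>a\<close> is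
      read in \<open>x\<close> and \<open>y\<close>, \<open>b\<close> in \<open>x'\<close> and
      \<open>y'\<close>; agreement on \<open>pa E j\<close> survives because \<open>k\<close> is not
      a parent of \<open>j\<close>.\<close>
    case False
    then have pa: "pa E k \<inter> ?U = {}"
      by (auto simp: desc_def pa_def intro: trancl_into_trancl)
    have "x i = y i" "y' i = x' i" if "i \<in> pa E k" for i
    proof -
      have "i \<notin> ?U" using that pa by blast
      then show "x i = y i" "y' i = x' i"
        by (rule Cons.prems(2), rule Cons.prems(3)[symmetric])
    qed
    then have f: "w I k (x(k := a)) = w I k (y(k := a))" "w J k (y'(k := a)) = w J k (x'(k := a))" for a
      unfolding w_def
      by (auto intro!: arg_cong[of _ _ Var] cond_label_cong)
    have IH: "?t I (x(k := a)) * ?t J (y'(k := b)) = ?t I (y(k := a)) * ?t J (x'(k := b))" for a b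
      by (rule Cons.IH) (use Cons.prems False k in auto)
    have "tree_sum d (w I) (k # ks) x * tree_sum d (w J) (k # ks) y' =
        (\<Sum>a\<in>{1..d k}. \<Sum>b\<in>{1..d k}. w I k (x(k := a)) * w J k (y'(k := b)) *
          (?t I (x(k := a)) * ?t J (y'(k := b))))"
      by (simp add: sum_product mult_ac)
    also have "\<dots> = (\<Sum>a\<in>{1..d k}. \<Sum>b\<in>{1..d k}. w I k (y(k := a)) * w J k (x'(k := b)) *
          (?t I (y(k := a)) * ?t J (x'(k := b))))"
      by (simp only: f IH)
    also have "\<dots> = tree_sum d (w I) (k # ks) y * tree_sum d (w J) (k # ks) x'"
      by (simp add: sum_product mult_ac)
    finally show ?thesis .
  qed
qed simp

text \<open>\<open>tree_sum_exchange\<close> is applied to the four states obtained from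
  \<open>x\<close> and \<open>x'\<close> by setting the current variable to \<open>a\<close> or
  \<open>b\<close>.\<close>

lemma tree_balanced_if_perfect:
  assumes "perfect p E" ancestral
  shows tree_balanced
  unfolding tree_balanced_def
proof (intro allI ballI impI)
  fix n I J x x' a b
  let ?j = "\<pi> ! n"
  assume n: "n < p" and IJ: "I \<in> \<I>" "J \<in> \<I>" and x: "x \<in> S n" "x' \<in> S n"
    and t: "target I ?j = target J ?j" and pa: "restrict x (pa E ?j) = restrict x' (pa E ?j)"
  have "distinct (take n \<pi> @ ?j # drop (Suc n) \<pi>)"
    using distinct_\<pi> id_take_nth_drop[of n \<pi>] n by simp
  then have disj: "set (take n \<pi>) \<inter> set (drop (Suc n) \<pi>) = {}" "?j \<notin> set (drop (Suc n) \<pi>)"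
    by auto
  \<comment> \<open>Descendants of \<open>?j\<close> come later in the ordering, so both states have
    the default value \<open>undefined\<close> there. This supplies the agreement on descendants
    that the exchange asks for.\<close>
  have undef: "x i = undefined" "x' i = undefined" if "i \<in> desc ?j" for i
  proof -
    have "i \<in> {1..p}"
      using that dag trancl_subset_Sigma[of E "{1..p}"] by (auto simp: desc_def dag_def)
    then obtain m where m: "m < p" "i = \<pi> ! m" by (rule position)
    have "n < m"
    proof -
      have "(?j, i) \<in> E\<^sup>+" using that by (simp add: desc_def)
      then have "\<forall>m<p. i = \<pi> ! m \<longrightarrow> n < m"
      proof (induction rule: trancl_induct)
        case (step k l)
        then have "k \<in> {1..p}" using dag by (auto simp: dag_def)
        then obtain q where "q < p" "k = \<pi> ! q" by (rule position)
        with step show ?case by (metis edge_position less_trans)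
      qed (use n edge_position in auto)
      with m show ?thesis by blast
    qed
    then have "i \<notin> set (take n \<pi>)"
      using m n distinct_\<pi> by (auto simp: in_set_conv_nth nth_eq_iff_index_eq)
    then show "x i = undefined" "x' i = undefined"
      using x by (auto simp: states_def PiE_iff extensional_def)
  qed
  have agree: "x i = x' i" if "i \<in> pa E ?j" for i
    using fun_cong[OF pa, of i] that by simp
  have "tree_sum d (\<lambda>k x. Var (cond_label E I k x)) (drop (Suc n) \<pi>) (x(?j := a)) *
        tree_sum d (\<lambda>k x. Var (cond_label E J k x)) (drop (Suc n) \<pi>) (x'(?j := b)) =
        tree_sum d (\<lambda>k x. Var (cond_label E I k x)) (drop (Suc n) \<pi>) (x(?j := b)) *
        tree_sum d (\<lambda>k x. Var (cond_label E J k x)) (drop (Suc n) \<pi>) (x'(?j := a))"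
    by (rule tree_sum_exchange[OF assms(1) target_desc[OF assms(2) IJ t]])
      (use disj pa_before[OF n] undef agree in auto)
  then show "tpoly I (Suc n) (x(?j := a)) * tpoly J (Suc n) (x'(?j := b)) =
      tpoly J (Suc n) (x'(?j := a)) * tpoly I (Suc n) (x(?j := b))"
    by (simp add: tpoly_def mult.commute)
qed

section \<open>Unbalanced pairs outside the perfect ancestral case\<close>

lemma eval_tpoly_single_factor:
  fixes h :: "(nat \<Rightarrow> nat) \<Rightarrow> real"
  assumes "\<And>l x. s (cond_label E I l x) = (if l = k then h x else 1)"
    and "\<And>l a x. l \<in> set (drop n \<pi>) \<Longrightarrow> h (x(l := a)) = h x" and "k \<in> set (drop n \<pi>)"
  shows "real.peval s (tpoly I n x) = (\<Prod>l\<in>set (drop n \<pi>). real (d l)) * h x"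
  unfolding tpoly_def real.peval_tree_sum real.peval_Var assms(1)
  using tree_sum_single_factor[of "drop n \<pi>" h d k x] assms(2,3) distinct_\<pi> by simp

lemma in_drop_if_parent:
  assumes "n < p" "(\<pi> ! n, k) \<in> E"
  shows "k \<in> set (drop (Suc n) \<pi>)"
proof -
  have "k \<in> {1..p}" using assms dag by (auto simp: dag_def)
  then obtain m where m: "m < p" "k = \<pi> ! m" by (rule position)
  with assms have "n < m" by (auto intro: edge_position)
  then have "k = drop (Suc n) \<pi> ! (m - Suc n)" "m - Suc n < length (drop (Suc n) \<pi>)"
    using m by auto
  then show ?thesis by (metis nth_mem)
qed

lemma notin_drop:
  assumes "m < n" "n \<le> p"
  shows "\<pi> ! m \<notin> set (drop n \<pi>)"
  using assms distinct_\<pi> by (auto simp: in_set_conv_nth nth_eq_iff_index_eq)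

lemma prod_d_pos: "0 < (\<Prod>l\<in>set (drop n \<pi>). real (d l))"
proof (rule prod_pos)
  fix l assume "l \<in> set (drop n \<pi>)"
  then have "l \<in> {1..p}" using set_drop_subset set_\<pi> by fastforce
  then show "0 < real (d l)" using d_pos by simp
qed

text \<open>Let \<open>i\<close> precede \<open>j\<close>, both nonadjacent parents of
  \<open>k\<close>. Nodes at the position of \<open>j\<close> whose states differ only at
  \<open>i\<close> share a stage, since \<open>i\<close> is not a parent of \<open>j\<close>; but
  below them the factor of \<open>k\<close> couples the values of \<open>i\<close> and
  \<open>j\<close>.\<close>

lemma perfect_if_tree_balanced:
  assumes tree_balanced
  shows "perfect p E"
proof (rule ccontr)
  assume "\<not> perfect p E"
  then obtain k i j where ij: "(i, k) \<in> E" "(j, k) \<in> E" "i \<noteq> j" "(i, j) \<notin> E" "(j, i) \<notin> E"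
    by (auto simp: perfect_def pa_def)
  then have "i \<in> {1..p}" "j \<in> {1..p}" using dag by (auto simp: dag_def)
  then obtain m n where "m < p" "n < p" "i = \<pi> ! m" "j = \<pi> ! n" by (meson position)
  with ij obtain m n where mn: "m < n" "n < p" "(\<pi> ! m, k) \<in> E" "(\<pi> ! n, k) \<in> E" "(\<pi> ! m, \<pi> ! n) \<notin> E"
    by (metis linorder_neqE_nat)
  define i j where "i = \<pi> ! m" and "j = \<pi> ! n"
  have ne: "i \<noteq> j" using mn distinct_\<pi> by (simp add: i_def j_def nth_eq_iff_index_eq)
  \<comment> \<open>Weight 2 marks the labels of \<open>k\<close> for which both parents have value
    1. The interpolating polynomials after reading \<open>j\<close> then evaluate to
    \<open>C\<close>, the number of leaves below the node, times \<open>h\<close>.\<close>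
  define s :: "label \<Rightarrow> real" where
    "s l = (case l of FSym K l a y \<Rightarrow> if l = k \<and> y i = 1 \<and> y j = 1 then 2 else 1 | _ \<Rightarrow> 1)" for l
  define h :: "(nat \<Rightarrow> nat) \<Rightarrow> real" where "h x = (if x i = 1 \<and> x j = 1 then 2 else 1)" for x
  define C where "C = (\<Prod>l\<in>set (drop (Suc n) \<pi>). real (d l))"
  have notin: "i \<notin> set (drop (Suc n) \<pi>)" "j \<notin> set (drop (Suc n) \<pi>)"
    using mn notin_drop by (auto simp: i_def j_def)
  have ev: "real.peval s (tpoly {} (Suc n) x) = C * h x" for x
    unfolding C_def
  proof (rule eval_tpoly_single_factor)
    show "s (cond_label E {} l x) = (if l = k then h x else 1)" for l x
      using mn by (auto simp: s_def h_def cond_label_def pa_def i_def j_def)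
    show "h (x(l := a)) = h x" if "l \<in> set (drop (Suc n) \<pi>)" for l a x
      using notin that by (auto simp: h_def)
    show "k \<in> set (drop (Suc n) \<pi>)"
      using mn in_drop_if_parent by auto
  qed
  define x where "x = (\<lambda>l\<in>set (take n \<pi>). 1 :: nat)"
  have i: "i \<in> set (take n \<pi>)" using mn by (auto simp: i_def in_set_conv_nth)
  have sub: "set (take n \<pi>) \<subseteq> {1..p}" using set_take_subset set_\<pi> by fastforce
  have x: "x \<in> S n" using sub d_pos by (fastforce simp: x_def states_def)
  have "2 \<le> d i" using i sub d_ge_2 by auto
  then have x': "x(i := 2) \<in> S n"
    using x i by (auto simp: states_def PiE_iff extensional_def)
  have "2 \<le> d j" using nth_\<pi>[OF mn(2)] d_ge_2 by (simp add: j_def)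
  then have "tpoly {} (Suc n) (x(j := 1)) * tpoly {} (Suc n) (x(i := 2, j := 2)) =
      tpoly {} (Suc n) (x(i := 2, j := 1)) * tpoly {} (Suc n) (x(j := 2))"
    using assms[unfolded tree_balanced_def, rule_format, OF mn(2) empty_target empty_target x x', of 1 2]
      mn by (auto simp: j_def i_def pa_def restrict_def fun_eq_iff)
  \<comment> \<open>The children \<open>j = 1\<close> and \<open>j = 2\<close> have the values
    \<open>2 * C\<close> and \<open>C\<close> if \<open>i = 1\<close>, but \<open>C\<close> and
    \<open>C\<close> if \<open>i = 2\<close>.\<close>
  from arg_cong[OF this, of "real.peval s"] have "C * 2 * C = C * C"
    using ne i by (auto simp: ev h_def x_def)
  then show False using prod_d_pos[of "Suc n", folded C_def] by simp
qed

text \<open>Nodes of the copies for \<open>{}\<close> and \<open>I\<close> with a common state, at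
  the position of \<open>j\<close>, share a stage because \<open>j\<close> lies outside
  \<open>I\<close>. Below them only the copy for \<open>I\<close> has a factor of \<open>k\<close>
  with superscript \<open>I\<close>, and that factor depends on the value of
  \<open>j\<close>.\<close>

lemma ancestral_if_tree_balanced:
  assumes tree_balanced
  shows ancestral
  unfolding ancestral_def
proof (intro ballI allI impI, rule ccontr)
  fix I j k assume I: "I \<in> \<I>" and jk: "(j, k) \<in> E" "k \<in> I" "j \<notin> I"
  have "j \<in> {1..p}" using jk dag by (auto simp: dag_def)
  then obtain n where n: "n < p" "j = \<pi> ! n" by (rule position)
  define s :: "label \<Rightarrow> real" where
    "s l = (case l of FSym K l a y \<Rightarrow> if K = I \<and> l = k \<and> y j = 1 then 2 else 1 | _ \<Rightarrow> 1)" for l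
  define h :: "(nat \<Rightarrow> nat) \<Rightarrow> real" where "h x = (if x j = 1 then 2 else 1)" for x
  define C where "C = (\<Prod>l\<in>set (drop (Suc n) \<pi>). real (d l))"
  have k: "k \<in> set (drop (Suc n) \<pi>)" using in_drop_if_parent n jk by auto
  have notin: "j \<notin> set (drop (Suc n) \<pi>)" using n notin_drop by auto
  have ev: "real.peval s (tpoly I (Suc n) x) = C * h x" for x
    unfolding C_def
    by (rule eval_tpoly_single_factor[OF _ _ k])
      (use jk notin in \<open>auto simp: s_def h_def cond_label_def pa_def\<close>)
  \<comment> \<open>\<open>I\<close> contains \<open>k\<close> and so is nonempty; hence no label of
    the copy for \<open>{}\<close> has weight 2, and the constant 1 takes the role of
    \<open>h\<close>.\<close>
  have ev0: "real.peval s (tpoly {} (Suc n) x) = C * 1" for x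
    unfolding C_def
    by (rule eval_tpoly_single_factor[OF _ _ k])
      (use jk in \<open>auto simp: s_def cond_label_def\<close>)
  define x where "x = (\<lambda>l\<in>set (take n \<pi>). 1 :: nat)"
  have "set (take n \<pi>) \<subseteq> {1..p}" using set_take_subset set_\<pi> by fastforce
  then have x: "x \<in> S n" using d_pos by (fastforce simp: x_def states_def)
  have "2 \<le> d j" using nth_\<pi>[OF n(1)] d_ge_2 by (simp add: n)
  then have "tpoly {} (Suc n) (x(j := 1)) * tpoly I (Suc n) (x(j := 2)) =
      tpoly I (Suc n) (x(j := 1)) * tpoly {} (Suc n) (x(j := 2))"
    using assms[unfolded tree_balanced_def, rule_format, OF n(1) empty_target I x x, of 1 2] jk
    by (auto simp: n target_def)
  from arg_cong[OF this, of "real.peval s"] have "C * C = C * 2 * C"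
    by (simp add: ev ev0 h_def)
  then show False using prod_d_pos[of "Suc n", folded C_def] by simp
qed

lemma tree_balanced_iff: "tree_balanced \<longleftrightarrow> perfect p E \<and> ancestral"
  using tree_balanced_if_perfect perfect_if_tree_balanced ancestral_if_tree_balanced by blast

end

section \<open>Balancedness and the two ideals\<close>

lemma mpoly_ring_simps [simp]:
  "carrier (mpoly_ring X) = {q. \<forall>m\<in>Poly_Mapping.keys q. Poly_Mapping.keys m \<subseteq> X}"
  "\<zero>\<^bsub>mpoly_ring X\<^esub> = 0" "\<one>\<^bsub>mpoly_ring X\<^esub> = 1"
  "x \<oplus>\<^bsub>mpoly_ring X\<^esub> y = x + y" "x \<otimes>\<^bsub>mpoly_ring X\<^esub> y = x * y"
  by (simp_all add: mpoly_ring_def)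

definition in_vars :: "'x set \<Rightarrow> 'x mpoly \<Rightarrow> bool" where
  "in_vars X q \<longleftrightarrow> (\<forall>m\<in>Poly_Mapping.keys q. Poly_Mapping.keys m \<subseteq> X)"

lemma in_vars_add: "in_vars X q \<Longrightarrow> in_vars X r \<Longrightarrow> in_vars X (q + r)"
  using keys_add[of q r] by (auto simp: in_vars_def)

lemma in_vars_mult: "in_vars X q \<Longrightarrow> in_vars X r \<Longrightarrow> in_vars X (q * r)"
  unfolding in_vars_def
proof
  fix m assume qr: "\<forall>m\<in>Poly_Mapping.keys q. Poly_Mapping.keys m \<subseteq> X"
    "\<forall>m\<in>Poly_Mapping.keys r. Poly_Mapping.keys m \<subseteq> X" and "m \<in> Poly_Mapping.keys (q * r)"
  then obtain a b where "m = a + b" "a \<in> Poly_Mapping.keys q" "b \<in> Poly_Mapping.keys r"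
    using keys_mult[of q r] by blast
  then show "Poly_Mapping.keys m \<subseteq> X"
    using qr keys_add[of a b] by blast
qed

lemma in_vars_uminus: "in_vars X q \<Longrightarrow> in_vars X (- q)"
  by (simp add: in_vars_def in_keys_iff)

lemma in_vars_diff: "in_vars X q \<Longrightarrow> in_vars X r \<Longrightarrow> in_vars X (q - r)"
  using in_vars_add[of X q "- r"] in_vars_uminus[of X r] by simp

lemma in_vars_0 [simp]: "in_vars X 0" and in_vars_1 [simp]: "in_vars X 1"
  by (auto simp: in_vars_def)

lemma in_vars_Var: "x \<in> X \<Longrightarrow> in_vars X (Var x)"
  by (simp add: in_vars_def Var_def)

lemma in_vars_sum: "(\<And>i. i \<in> A \<Longrightarrow> in_vars X (f i)) \<Longrightarrow> in_vars X (\<Sum>i\<in>A. f i)"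
  by (induction A rule: infinite_finite_induct) (auto intro: in_vars_add)

lemma in_vars_prod: "(\<And>i. i \<in> A \<Longrightarrow> in_vars X (f i)) \<Longrightarrow> in_vars X (\<Prod>i\<in>A. f i)"
  by (induction A rule: infinite_finite_induct) (auto intro: in_vars_mult)

lemmas in_vars_intros =
  in_vars_add in_vars_mult in_vars_diff in_vars_Var in_vars_sum in_vars_prod

lemma real_peval_cong:
  assumes "in_vars X q" "\<And>x. x \<in> X \<Longrightarrow> f x = g x"
  shows "real.peval f q = real.peval g q"
  unfolding real.peval_def mon_def
  by (intro sum.cong prod.cong refl arg_cong2[of _ _ _ _ "(*)"] arg_cong2[of _ _ _ _ "(^)"])
    (use assms in \<open>auto simp: in_vars_def\<close>)

lemma carrier_mpoly_ring: "q \<in> carrier (mpoly_ring X) \<longleftrightarrow> in_vars X q"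
  by (simp add: in_vars_def)

lemma cring_mpoly_ring: "cring (mpoly_ring X)"
proof (rule cringI)
  show "abelian_group (mpoly_ring X)"
  proof (rule abelian_groupI)
    fix q assume "q \<in> carrier (mpoly_ring X)"
    then have "- q \<in> carrier (mpoly_ring X)"
      unfolding carrier_mpoly_ring by (rule in_vars_uminus)
    then show "\<exists>r\<in>carrier (mpoly_ring X). r \<oplus>\<^bsub>mpoly_ring X\<^esub> q = \<zero>\<^bsub>mpoly_ring X\<^esub>"
      by (intro bexI[of _ "- q"]) auto
  qed (simp_all add: carrier_mpoly_ring in_vars_add add_ac del: mpoly_ring_simps(1))
  show "comm_monoid (mpoly_ring X)"
    by (rule comm_monoidI)
      (simp_all add: carrier_mpoly_ring in_vars_mult mult_ac del: mpoly_ring_simps(1))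
qed (simp add: ring_distribs)

text \<open>The polynomials of the ring that vanish at \<open>s\<close> form an ideal containing
  \<open>G\<close>, and the generated ideal is the least one.\<close>

lemma genideal_vanishes:
  assumes "q \<in> genideal (mpoly_ring X) G" "G \<subseteq> carrier (mpoly_ring X)"
    and "\<And>g. g \<in> G \<Longrightarrow> real.peval s g = 0"
  shows "real.peval s q = 0"
proof -
  interpret cring "mpoly_ring X" by (rule cring_mpoly_ring)
  let ?J = "{q \<in> carrier (mpoly_ring X). real.peval s q = 0}"
  have "ideal ?J (mpoly_ring X)"
  proof (rule idealI)
    show "subgroup ?J (add_monoid (mpoly_ring X))"
    proof
      fix q assume q: "q \<in> ?J"
      have "\<ominus>\<^bsub>mpoly_ring X\<^esub> q = - q"
        using q in_vars_uminus[of X q]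
        by (intro minus_equality) (simp_all add: carrier_mpoly_ring del: mpoly_ring_simps(1))
      moreover have "real.peval s (- q) = 0"
        using q real.peval_minus[of s 0 q] by simp
      ultimately show "inv\<^bsub>add_monoid (mpoly_ring X)\<^esub> q \<in> ?J"
        using q in_vars_uminus[of X q]
        by (simp add: a_inv_def carrier_mpoly_ring del: mpoly_ring_simps(1))
    qed (auto simp: carrier_mpoly_ring in_vars_add simp del: mpoly_ring_simps(1))
  qed (auto simp: carrier_mpoly_ring in_vars_mult ring_axioms simp del: mpoly_ring_simps(1))
  moreover have "G \<subseteq> ?J" using assms(2,3) by blast
  ultimately have "genideal (mpoly_ring X) G \<subseteq> ?J" by (rule genideal_minimal)
  then show ?thesis using assms(1) by blast
qed

text \<open>The zero of the quotient ring is the coset \<open>N\<close> itself, so this turns the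
  kernel of a map into the quotient into a preimage of \<open>N\<close>.\<close>

lemma rcoset_eq_iff:
  assumes "ideal N (mpoly_ring X)"
  shows "N +>\<^bsub>mpoly_ring X\<^esub> q = N \<longleftrightarrow> q \<in> N"
proof
  interpret ideal N "mpoly_ring X" by (rule assms)
  have "0 \<in> N" using additive_subgroup.zero_closed[OF is_additive_subgroup] by simp
  then show "q \<in> N" if "N +>\<^bsub>mpoly_ring X\<^esub> q = N"
    using that by (force simp: a_r_coset_def')
  show "N +>\<^bsub>mpoly_ring X\<^esub> q = N" if "q \<in> N"
    by (rule a_coset_join2[OF a_Hcarr[OF that] a_subgroup that])
qed

section \<open>The toric kernel and the factorization ideal as preimages\<close>

context int_tree_setup
begin

abbreviation "R \<equiv> mpoly_ring (labels p d E \<I>)"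
abbreviation "N \<equiv> genideal R (sum_to_one p d E \<I>)"

lemma sum_to_one_carrier: "sum_to_one p d E \<I> \<subseteq> carrier R"
  unfolding sum_to_one_def subset_iff carrier_mpoly_ring
  by (auto intro!: in_vars_intros simp: labels_def)

lemma ideal_N: "ideal N R"
  using ring.genideal_ideal[OF cring.axioms(1)[OF cring_mpoly_ring] sum_to_one_carrier] .

lemma factorization_ideal_eq:
  "factorization_ideal p d E \<I> = {q \<in> carrier (mpoly_ring (indets p d \<I>)). toric_map p E q \<in> N}"
  unfolding factorization_ideal_def Let_def a_kernel_def'
  by (simp add: FactRing_def rcoset_eq_iff[OF ideal_N])

lemma toric_kernel_eq:
  "toric_kernel p d E \<I> = {q \<in> carrier (mpoly_ring (indets p d \<I>)). toric_map p E q = 0}"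
  by (simp add: toric_kernel_def a_kernel_def')

lemma
  shows N_add: "q \<in> N \<Longrightarrow> r \<in> N \<Longrightarrow> q + r \<in> N"
    and N_mult: "q \<in> N \<Longrightarrow> in_vars (labels p d E \<I>) r \<Longrightarrow> q * r \<in> N"
    and N_diff: "q \<in> N \<Longrightarrow> r \<in> N \<Longrightarrow> q - r \<in> N"
    and N_0: "0 \<in> N"
proof -
  interpret ideal N R by (rule ideal_N)
  show add: "q \<in> N \<Longrightarrow> r \<in> N \<Longrightarrow> q + r \<in> N" for q r
    using additive_subgroup.a_closed[OF is_additive_subgroup, of q r] by simp
  show mult: "q \<in> N \<Longrightarrow> in_vars (labels p d E \<I>) r \<Longrightarrow> q * r \<in> N" for q r
    using I_r_closed[of q r] by (simp add: carrier_mpoly_ring del: mpoly_ring_simps(1))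
  show "0 \<in> N" using additive_subgroup.zero_closed[OF is_additive_subgroup] by simp
  have "in_vars (labels p d E \<I>) (- 1)" by (rule in_vars_uminus[OF in_vars_1])
  then show "q \<in> N \<Longrightarrow> r \<in> N \<Longrightarrow> q - r \<in> N"
    using add[of q "r * (- 1)"] mult[of r "- 1"] by simp
qed

lemma N_sum: "(\<And>i. i \<in> A \<Longrightarrow> f i \<in> N) \<Longrightarrow> (\<Sum>i\<in>A. f i) \<in> N"
  by (induction A rule: infinite_finite_induct) (auto intro: N_add N_0)

section \<open>Interpolating polynomials and leaf sums modulo the sum-to-one relations\<close>

lemma pa_in_take:
  assumes "k \<in> set (take n \<pi>)"
  shows "pa E k \<subseteq> set (take n \<pi>)"
proof -
  obtain m where m: "m < n" "m < p" "k = \<pi> ! m"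
    using assms by (auto simp: in_set_conv_nth)
  then have "pa E k \<subseteq> set (take m \<pi>)" using pa_before by auto
  also have "\<dots> \<subseteq> set (take n \<pi>)" using m by (intro set_take_subset_set_take) simp
  finally show ?thesis .
qed

lemma cond_label_earlier:
  assumes "n < p" "l \<in> set (take n \<pi>)"
  shows "cond_label E I l (x(\<pi> ! n := a)) = cond_label E I l x"
  using pa_in_take[OF assms(2)] assms(2) nth_notin_take[OF assms(1)]
  by (intro cond_label_cong) auto

lemma restrict_states: "x \<in> states d A \<Longrightarrow> B \<subseteq> A \<Longrightarrow> restrict x B \<in> states d B"
  by (auto simp: states_def)

lemma label_in_labels:
  assumes "I \<in> \<I>" "n < p" "x \<in> S n" "a \<in> {1..d (\<pi> ! n)}"
  shows "cond_label E I (\<pi> ! n) (x(\<pi> ! n := a)) \<in> labels p d E \<I>"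
  using assms nth_\<pi>[of n] restrict_states[OF assms(3) pa_before[OF assms(2)]] empty_target
  by (auto simp: cond_label_update labels_def target_def)

lemma tpoly_step:
  assumes "n < p"
  shows "tpoly I n x = (\<Sum>a\<in>{1..d (\<pi> ! n)}.
    Var (cond_label E I (\<pi> ! n) (x(\<pi> ! n := a))) * tpoly I (Suc n) (x(\<pi> ! n := a)))"
  by (simp add: tpoly_def drop_\<pi>[OF assms])

lemma in_vars_tpoly:
  assumes "n \<le> p" "I \<in> \<I>" "x \<in> S n"
  shows "in_vars (labels p d E \<I>) (tpoly I n x)"
  using assms(1,3)
proof (induction n arbitrary: x rule: inc_induct)
  case (step n)
  then show ?case
    unfolding tpoly_step[OF step.hyps(2)]
    by (intro in_vars_sum in_vars_mult in_vars_Var label_in_labels step.IH states_update assms(2))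
qed (simp add: tpoly_def)

text \<open>Induction from the leaves upwards: if v has children v_a reached by labels f_a, then
  t(v) - 1 is the sum of all (t(v_a) - 1) f_a plus the relation that the f_a sum to one.\<close>

lemma tpoly_minus_1:
  assumes "n \<le> p" "I \<in> \<I>" "x \<in> S n"
  shows "tpoly I n x - 1 \<in> N"
  using assms(1,3)
proof (induction n arbitrary: x rule: inc_induct)
  case base
  then show ?case by (simp add: tpoly_def N_0)
next
  case (step n)
  let ?k = "\<pi> ! n"
  let ?f = "\<lambda>a. cond_label E I ?k (x(?k := a))"
  have n: "n < p" using step by simp
  have y: "restrict x (pa E ?k) \<in> states d (pa E ?k)"
    using restrict_states pa_before n step.prems by blast
  have "(\<Sum>a\<in>{1..d ?k}. Var (?f a)) - 1 \<in> sum_to_one p d E \<I>"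
    using y nth_\<pi>[OF n] assms(2) empty_target
    unfolding sum_to_one_def cond_label_update target_def by auto
  then have "(\<Sum>a\<in>{1..d ?k}. Var (?f a)) - 1 \<in> N"
    using ring.genideal_self[OF cring.axioms(1)[OF cring_mpoly_ring] sum_to_one_carrier] by blast
  moreover have "(\<Sum>a\<in>{1..d ?k}. (tpoly I (Suc n) (x(?k := a)) - 1) * Var (?f a)) \<in> N"
    using step.IH states_update[OF n step.prems] label_in_labels[OF assms(2) n step.prems]
    by (intro N_sum N_mult in_vars_Var) auto
  ultimately have "(\<Sum>a\<in>{1..d ?k}. (tpoly I (Suc n) (x(?k := a)) - 1) * Var (?f a)) +
      ((\<Sum>a\<in>{1..d ?k}. Var (?f a)) - 1) \<in> N"
    using N_add by blast
  then show ?case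
    by (simp add: tpoly_step[OF n] sum_subtractf algebra_simps)
qed

text \<open>\<open>leaf_sum F (drop n \<pi>) x\<close> adds up \<open>F\<close> over the leaves below the node with state \<open>x\<close>.\<close>

fun leaf_sum :: "((nat \<Rightarrow> nat) \<Rightarrow> 'a::comm_monoid_add) \<Rightarrow> nat list \<Rightarrow> (nat \<Rightarrow> nat) \<Rightarrow> 'a" where
  "leaf_sum F [] x = F x"
| "leaf_sum F (k # ks) x = (\<Sum>a\<in>{1..d k}. leaf_sum F ks (x(k := a)))"

lemma peval_leaf_sum:
  "poly.peval \<sigma> (leaf_sum F ks x) = leaf_sum (\<lambda>z. poly.peval \<sigma> (F z)) ks x"
  by (induction ks arbitrary: x) auto

text \<open>The paths from the root to the leaves below a node share their initial labels, which
  factor out; the rest sums to t(v). The factor \<open>c\<close> makes room for the symbol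
  a_I.\<close>

lemma leaf_sum_eq_tpoly:
  assumes "n \<le> p" "x \<in> S n"
  shows "leaf_sum (\<lambda>z. c * (\<Prod>k\<in>{1..p}. Var (cond_label E I k z))) (drop n \<pi>) x =
    c * (\<Prod>k\<in>set (take n \<pi>). Var (cond_label E I k x)) * tpoly I n x"
  using assms
proof (induction n arbitrary: x rule: inc_induct)
  case base
  then show ?case by (simp add: tpoly_def set_\<pi>)
next
  case (step n)
  let ?k = "\<pi> ! n"
  have n: "n < p" using step by simp
  have "leaf_sum (\<lambda>z. c * (\<Prod>k\<in>{1..p}. Var (cond_label E I k z))) (drop n \<pi>) x =
    (\<Sum>a\<in>{1..d ?k}. c * (\<Prod>k\<in>set (take (Suc n) \<pi>). Var (cond_label E I k (x(?k := a)))) *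
      tpoly I (Suc n) (x(?k := a)))"
    using step.IH states_update[OF n step.prems] by (simp add: drop_\<pi>[OF n] del: fun_upd_apply)
  also have "\<dots> = (\<Sum>a\<in>{1..d ?k}. c * (\<Prod>k\<in>set (take n \<pi>). Var (cond_label E I k x)) *
      (Var (cond_label E I ?k (x(?k := a))) * tpoly I (Suc n) (x(?k := a))))"
    using nth_notin_take[OF n] by (simp add: set_take_Suc[OF n] cond_label_earlier[OF n] mult_ac del: fun_upd_apply)
  also have "\<dots> = c * (\<Prod>k\<in>set (take n \<pi>). Var (cond_label E I k x)) * tpoly I n x"
    unfolding tpoly_step[OF n] sum_distrib_left ..
  finally show ?case .
qed

text \<open>A lift of t(v) to the indeterminates of the leaves: the toric map sends it to t(v) times
  the monomial of the path from the root to v.\<close>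

definition leaf_poly ::
  "nat set \<Rightarrow> nat \<Rightarrow> (nat \<Rightarrow> nat) \<Rightarrow> (nat set \<times> (nat \<Rightarrow> nat)) mpoly" where
  "leaf_poly I n x = leaf_sum (\<lambda>z. Var (I, z)) (drop n \<pi>) x"

definition path_monomial :: "nat set \<Rightarrow> nat \<Rightarrow> (nat \<Rightarrow> nat) \<Rightarrow> label mpoly" where
  "path_monomial I n x = Var (ASym I) * (\<Prod>k\<in>set (take n \<pi>). Var (cond_label E I k x))"

lemma toric_map_leaf_poly:
  assumes "n \<le> p" "x \<in> S n"
  shows "toric_map p E (leaf_poly I n x) = path_monomial I n x * tpoly I n x"
  unfolding toric_map_def mpoly_hom_eq_peval leaf_poly_def peval_leaf_sum poly.peval_Var
    prod.case path_monomial_def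
  by (rule leaf_sum_eq_tpoly[OF assms])

lemma in_vars_leaf_poly:
  assumes "n \<le> p" "I \<in> \<I>" "x \<in> S n"
  shows "in_vars (indets p d \<I>) (leaf_poly I n x)"
  using assms(1,3)
proof (induction n arbitrary: x rule: inc_induct)
  case base
  then show ?case
    using assms(2) set_\<pi> by (auto simp: leaf_poly_def indets_def intro!: in_vars_Var)
next
  case (step n)
  then show ?case
    unfolding leaf_poly_def drop_\<pi>[OF step.hyps(2)] leaf_sum.simps
    by (intro in_vars_sum step.IH[unfolded leaf_poly_def] states_update)
qed

lemma in_vars_path_monomial:
  assumes "n \<le> p" "I \<in> \<I>" "x \<in> S n"
  shows "in_vars (labels p d E \<I>) (path_monomial I n x)"
proof -
  have "cond_label E I k x \<in> labels p d E \<I>" if "k \<in> set (take n \<pi>)" for k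
  proof -
    have "restrict x (pa E k) \<in> states d (pa E k)"
      using restrict_states[OF assms(3) pa_in_take[OF that]] .
    moreover have "x k \<in> {1..d k}" using assms(3) that by (auto simp: states_def)
    moreover have "k \<in> {1..p}" using that set_take_subset set_\<pi> by fastforce
    ultimately show ?thesis
      using assms(2) empty_target by (auto simp: cond_label_def labels_def)
  qed
  moreover have "ASym I \<in> labels p d E \<I>" using assms(2) by (simp add: labels_def)
  ultimately show ?thesis
    unfolding path_monomial_def by (intro in_vars_mult in_vars_prod in_vars_Var)
qed

text \<open>For a same-stage pair, \<open>q\<close> maps to a monomial times the defect in the
  balance identity. This image is zero modulo the sum-to-one relations, hence zero by the assumed
  equality.\<close>

lemma tree_balanced_if_kernels_eq:
  assumes "toric_kernel p d E \<I> = factorization_ideal p d E \<I>"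
  shows tree_balanced
  unfolding tree_balanced_def
proof (intro allI ballI impI)
  fix n I J x x' a b
  let ?j = "\<pi> ! n"
  assume n: "n < p" and IJ: "I \<in> \<I>" "J \<in> \<I>" and x: "x \<in> S n" "x' \<in> S n"
    and ab: "a \<in> {1..d ?j}" "b \<in> {1..d ?j}"
    and t: "target I ?j = target J ?j" and pa: "restrict x (pa E ?j) = restrict x' (pa E ?j)"
  define v1 v2 w1 w2 where v: "v1 = x(?j := a)" "v2 = x(?j := b)" "w1 = x'(?j := a)" "w2 = x'(?j := b)"
  have S: "v1 \<in> S (Suc n)" "v2 \<in> S (Suc n)" "w1 \<in> S (Suc n)" "w2 \<in> S (Suc n)"
    unfolding v using states_update n x ab by blast+
  define t1 t2 u1 u2 where tu: "t1 = tpoly I (Suc n) v1" "t2 = tpoly I (Suc n) v2"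
    "u1 = tpoly J (Suc n) w1" "u2 = tpoly J (Suc n) w2"
  define q where "q = leaf_poly I (Suc n) v1 * leaf_poly J (Suc n) w2 -
    leaf_poly J (Suc n) w1 * leaf_poly I (Suc n) v2"
  have q: "in_vars (indets p d \<I>) q"
    unfolding q_def using n IJ S by (intro in_vars_intros in_vars_leaf_poly) auto
  define M where "M = path_monomial I (Suc n) v1 * path_monomial J (Suc n) w2"
  \<comment> \<open>Labels above the two nodes occur in both products, and the common stage matches
    the last labels of \<open>v1\<close> and \<open>w1\<close> and those of \<open>v2\<close> and
    \<open>w2\<close>.\<close>
  have M: "M = path_monomial J (Suc n) w1 * path_monomial I (Suc n) v2"
  proof -
    have "(\<Prod>k\<in>set (take n \<pi>). Var (cond_label E I k v1)) = (\<Prod>k\<in>set (take n \<pi>). Var (cond_label E I k v2))"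
      "(\<Prod>k\<in>set (take n \<pi>). Var (cond_label E J k w1)) = (\<Prod>k\<in>set (take n \<pi>). Var (cond_label E J k w2))"
      unfolding v by (simp_all add: cond_label_earlier[OF n] del: fun_upd_apply)
    moreover have "cond_label E I ?j v1 = cond_label E J ?j w1" "cond_label E I ?j v2 = cond_label E J ?j w2"
      unfolding v cond_label_update t pa by auto
    ultimately show ?thesis
      using nth_notin_take[OF n] by (simp add: M_def path_monomial_def set_take_Suc[OF n] mult_ac)
  qed
  have "toric_map p E q = M * (t1 * u2) - M * (u1 * t2)"
  proof -
    have "toric_map p E q = toric_map p E (leaf_poly I (Suc n) v1) * toric_map p E (leaf_poly J (Suc n) w2) -
        toric_map p E (leaf_poly J (Suc n) w1) * toric_map p E (leaf_poly I (Suc n) v2)"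
      by (simp add: q_def toric_map_def mpoly_hom_eq_peval)
    also have "\<dots> = M * (t1 * u2) - M * (u1 * t2)"
      using n S by (subst (2) M) (simp add: toric_map_leaf_poly M_def tu mult_ac)
    finally show ?thesis .
  qed
  then have toric: "toric_map p E q = M * (t1 * u2 - u1 * t2)"
    by (simp add: right_diff_distrib)
  have "t1 - 1 \<in> N" "t2 - 1 \<in> N" "u1 - 1 \<in> N" "u2 - 1 \<in> N"
    unfolding tu using n IJ S by (auto intro!: tpoly_minus_1)
  moreover have "in_vars (labels p d E \<I>) M" "in_vars (labels p d E \<I>) u2" "in_vars (labels p d E \<I>) t2"
    unfolding M_def tu using n IJ S by (auto intro!: in_vars_mult in_vars_path_monomial in_vars_tpoly)
  \<comment> \<open>Products of elements that are 1 modulo \<open>N\<close> are again 1: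
    \<open>t1 * u2 - 1 = (t1 - 1) * u2 + (u2 - 1)\<close>, and likewise for
    \<open>u1 * t2\<close>.\<close>
  ultimately have "(((t1 - 1) * u2 + (u2 - 1)) - ((u1 - 1) * t2 + (t2 - 1))) * M \<in> N"
    by (intro N_mult[OF N_diff[OF N_add[OF N_mult] N_add[OF N_mult]]])
  then have "toric_map p E q \<in> N"
    unfolding toric by (simp add: algebra_simps)
  then have "q \<in> factorization_ideal p d E \<I>"
    using q unfolding factorization_ideal_eq mem_Collect_eq carrier_mpoly_ring by blast
  then have "toric_map p E q = 0"
    unfolding assms[symmetric] toric_kernel_eq by blast
  then have zero: "M * (t1 * u2 - u1 * t2) = 0"
    by (simp add: toric)
  \<comment> \<open>The monomial \<open>M\<close> is positive at positive points, so it cancels from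
    the evaluated identity.\<close>
  have "t1 * u2 - u1 * t2 = 0"
  proof (rule mpoly_eq_0_if_vanishes)
    fix s :: "label \<Rightarrow> real" assume s: "\<And>x. 0 < s x"
    then have "0 < real.peval s M"
      unfolding M_def path_monomial_def real.peval_mult real.peval_prod real.peval_Var
      by (intro mult_pos_pos prod_pos ballI s)
    moreover have "real.peval s M * real.peval s (t1 * u2 - u1 * t2) = 0"
      using arg_cong[OF zero, of "real.peval s"] unfolding real.peval_mult by simp
    ultimately show "real.peval s (t1 * u2 - u1 * t2) = 0" by simp
  qed
  then show "tpoly I (Suc n) (x(?j := a)) * tpoly J (Suc n) (x'(?j := b)) =
      tpoly J (Suc n) (x'(?j := a)) * tpoly I (Suc n) (x(?j := b))"
    by (simp add: tu v)
qed

text \<open>The conditional weights s(e) t(v') / t(v) sum to one at v by the recursion for t(v), and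
  the ratios telescope along a path to a leaf. Balancedness makes t(v') / t(v) a function of the
  label alone, so the new weights are again values of the labels.\<close>

lemma stochastic_reweighting:
  fixes s :: "label \<Rightarrow> real"
  assumes bal: tree_balanced and s: "\<And>l. 0 < s l"
  obtains s' where "\<And>g. g \<in> sum_to_one p d E \<I> \<Longrightarrow> real.peval s' g = 0"
    and "\<And>I z. I \<in> \<I> \<Longrightarrow> z \<in> states d {1..p} \<Longrightarrow>
      s' (ASym I) * (\<Prod>k\<in>{1..p}. s' (cond_label E I k z)) =
      s (ASym I) * (\<Prod>k\<in>{1..p}. s (cond_label E I k z))"
proof -
  define t where "t I n x = real.peval s (tpoly I n x)" for I n x
  have t_pos: "0 < t I n x" for I n x
    unfolding t_def tpoly_def real.peval_tree_sum real.peval_Var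
  proof (rule tree_sum_pos)
    show "0 < d k" if "k \<in> set (drop n \<pi>)" for k
      using that set_drop_subset[of n \<pi>] set_\<pi> d_pos by auto
  qed (rule s)
  have t_step: "t I n x = (\<Sum>a\<in>{1..d (\<pi> ! n)}. s (cond_label E I (\<pi> ! n) (x(\<pi> ! n := a))) *
      t I (Suc n) (x(\<pi> ! n := a)))" if "n < p" for I n x
    unfolding t_def tpoly_step[OF that] by (simp del: fun_upd_apply)
  define ratio where "ratio I n x a = t I (Suc n) (x(\<pi> ! n := a)) / t I n x" for I n x a
  \<comment> \<open>The balance identity for \<open>a\<close> and \<open>b\<close> is multiplied by
    the weight of the label with value \<open>b\<close> and summed over \<open>b\<close>. The result
    is t(v_a) t(w) = t(w_a) t(v), where v_a and w_a are the children with value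
    \<open>a\<close>.\<close>
  have ratio_eq: "ratio I n x a = ratio J n x' a"
    if "n < p" "I \<in> \<I>" "J \<in> \<I>" "x \<in> S n" "x' \<in> S n" "a \<in> {1..d (\<pi> ! n)}"
      "target I (\<pi> ! n) = target J (\<pi> ! n)"
      "restrict x (pa E (\<pi> ! n)) = restrict x' (pa E (\<pi> ! n))" for I J n x x' a
  proof -
    let ?k = "\<pi> ! n"
    have "t I (Suc n) (x(?k := a)) * t J n x' = (\<Sum>b\<in>{1..d ?k}.
        s (cond_label E J ?k (x'(?k := b))) * (t I (Suc n) (x(?k := a)) * t J (Suc n) (x'(?k := b))))"
      by (simp add: t_step[OF that(1), of J] sum_distrib_left mult_ac del: fun_upd_apply)
    also have "\<dots> = (\<Sum>b\<in>{1..d ?k}.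
        s (cond_label E I ?k (x(?k := b))) * (t J (Suc n) (x'(?k := a)) * t I (Suc n) (x(?k := b))))"
    proof (rule sum.cong[OF refl])
      fix b assume b: "b \<in> {1..d ?k}"
      have "t I (Suc n) (x(?k := a)) * t J (Suc n) (x'(?k := b)) =
          t J (Suc n) (x'(?k := a)) * t I (Suc n) (x(?k := b))"
        unfolding t_def real.peval_mult[symmetric]
        using bal[unfolded tree_balanced_def, rule_format, OF that(1-6) b that(7,8)] by (rule arg_cong)
      then show "s (cond_label E J ?k (x'(?k := b))) * (t I (Suc n) (x(?k := a)) * t J (Suc n) (x'(?k := b))) =
          s (cond_label E I ?k (x(?k := b))) * (t J (Suc n) (x'(?k := a)) * t I (Suc n) (x(?k := b)))"
        by (simp only: cond_label_update that(7,8))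
    qed
    also have "\<dots> = t J (Suc n) (x'(?k := a)) * t I n x"
      by (simp add: t_step[OF that(1), of I] sum_distrib_left mult_ac del: fun_upd_apply)
    finally show ?thesis
      using t_pos[of I n x] t_pos[of J n x'] unfolding ratio_def
      by (simp add: frac_eq_eq del: fun_upd_apply)
  qed
  \<comment> \<open>The ratio as a function of the label; by \<open>ratio_eq\<close> it does not
    depend on the edge that is picked.\<close>
  define r where "r l = (SOME c. \<exists>I\<in>\<I>. \<exists>n<p. \<exists>x\<in>S n. \<exists>a\<in>{1..d (\<pi> ! n)}.
    l = cond_label E I (\<pi> ! n) (x(\<pi> ! n := a)) \<and> c = ratio I n x a)" for l
  have r: "r (cond_label E I (\<pi> ! n) (x(\<pi> ! n := a))) = ratio I n x a"
    if *: "I \<in> \<I>" "n < p" "x \<in> S n" "a \<in> {1..d (\<pi> ! n)}" for I n x a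
    unfolding r_def
  proof (rule some_equality)
    fix c assume "\<exists>J\<in>\<I>. \<exists>m<p. \<exists>x'\<in>S m. \<exists>b\<in>{1..d (\<pi> ! m)}.
      cond_label E I (\<pi> ! n) (x(\<pi> ! n := a)) = cond_label E J (\<pi> ! m) (x'(\<pi> ! m := b)) \<and>
      c = ratio J m x' b"
    then obtain J m x' b where J: "J \<in> \<I>" "m < p" "x' \<in> S m" "c = ratio J m x' b"
      and l: "\<pi> ! n = \<pi> ! m" "target I (\<pi> ! n) = target J (\<pi> ! m)" "a = b"
        "restrict x (pa E (\<pi> ! n)) = restrict x' (pa E (\<pi> ! m))"
      unfolding cond_label_update label.inject by blast
    have "n = m"
      using distinct_\<pi> *(2) J(2) l(1) by (simp add: nth_eq_iff_index_eq)
    then show "c = ratio I n x a"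
      using ratio_eq[OF *(2,1) J(1) *(3) _ *(4)] J l by simp
  qed (use * in blast)
  \<comment> \<open>The factor t(v_I) at \<open>ASym I\<close> cancels the first denominator of the
    telescoping product.\<close>
  define s' where "s' l = s l * (case l of ASym I \<Rightarrow> t I 0 (\<lambda>_. undefined) | FSym _ _ _ _ \<Rightarrow> r l)" for l
  have s'_cond: "s' (cond_label E I k z) = s (cond_label E I k z) * r (cond_label E I k z)" for I k z
    by (simp add: s'_def cond_label_def)
  show thesis
  proof (rule that)
    fix g assume "g \<in> sum_to_one p d E \<I>"
    then obtain I j y where g: "g = (\<Sum>a\<in>{1..d j}. Var (FSym I j a y)) - 1"
      and I: "I \<in> \<I>" "I = {} \<or> j \<in> I" and j: "j \<in> {1..p}" and y: "y \<in> states d (pa E j)"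
      unfolding sum_to_one_def by blast
    obtain n where n: "n < p" "j = \<pi> ! n" using j by (rule position)
    \<comment> \<open>Every sum-to-one relation arises at a node: the parent state \<open>y\<close>
      is extended by the default value 1 to all earlier variables.\<close>
    define x where "x = (\<lambda>i\<in>set (take n \<pi>). if i \<in> pa E j then y i else 1)"
    have "x i \<in> {1..d i}" if "i \<in> set (take n \<pi>)" for i
    proof -
      have "i \<in> {1..p}" using that set_take_subset set_\<pi> by fastforce
      then show ?thesis using that y d_pos[of i] by (auto simp: x_def states_def)
    qed
    then have x: "x \<in> S n" by (auto simp: states_def x_def)
    have "restrict x (pa E j) = y"
      using pa_before[OF n(1)] y
      by (auto simp: x_def n(2) states_def restrict_def fun_eq_iff PiE_iff extensional_def)
    moreover have "target I j = I" using I by (auto simp: target_def)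
    ultimately have l: "FSym I j a y = cond_label E I (\<pi> ! n) (x(\<pi> ! n := a))" for a
      by (simp add: cond_label_update n(2))
    have "(\<Sum>a\<in>{1..d j}. s' (FSym I j a y)) =
        (\<Sum>a\<in>{1..d j}. s (cond_label E I (\<pi> ! n) (x(\<pi> ! n := a))) * ratio I n x a)"
      unfolding l s'_cond by (rule sum.cong) (use r I n x in auto)
    also have "\<dots> = (\<Sum>a\<in>{1..d (\<pi> ! n)}. s (cond_label E I (\<pi> ! n) (x(\<pi> ! n := a))) *
        t I (Suc n) (x(\<pi> ! n := a))) / t I n x"
      by (simp add: ratio_def n(2) sum_divide_distrib del: fun_upd_apply)
    also have "\<dots> = 1"
      unfolding t_step[OF n(1), symmetric] using t_pos[of I n x] by simp
    finally show "real.peval s' g = 0" by (simp add: g)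
  next
    fix I z assume I: "I \<in> \<I>" and z: "z \<in> states d {1..p}"
    \<comment> \<open>Telescoping: after \<open>n\<close> factors along the path to \<open>z\<close>
      only the value at the current node is left. At a leaf, where \<open>n = p\<close>, this value
      is 1.\<close>
    have "t I 0 (\<lambda>_. undefined) * (\<Prod>k\<in>set (take n \<pi>). r (cond_label E I k z)) =
        t I n (restrict z (set (take n \<pi>)))" if "n \<le> p" for n
      using that
    proof (induction n)
      case (Suc n)
      let ?k = "\<pi> ! n" and ?x = "restrict z (set (take n \<pi>))"
      have n: "n < p" using Suc.prems by simp
      have upd: "?x(?k := z ?k) = restrict z (set (take (Suc n) \<pi>))"
        by (auto simp: set_take_Suc[OF n])
      have "set (take n \<pi>) \<subseteq> {1..p}" using set_take_subset set_\<pi> by fastforce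
      then have x: "?x \<in> S n" using restrict_states[OF z] by blast
      have "z ?k \<in> {1..d ?k}" using z nth_\<pi>[OF n] by (auto simp: states_def)
      moreover have "cond_label E I ?k z = cond_label E I ?k (?x(?k := z ?k))"
        using pa_before[OF n] by (intro cond_label_cong) auto
      ultimately have rk: "r (cond_label E I ?k z) = ratio I n ?x (z ?k)"
        using r[OF I n x] by (simp only:)
      have "t I 0 (\<lambda>_. undefined) * (\<Prod>k\<in>set (take (Suc n) \<pi>). r (cond_label E I k z)) =
          (t I 0 (\<lambda>_. undefined) * (\<Prod>k\<in>set (take n \<pi>). r (cond_label E I k z))) *
          r (cond_label E I ?k z)"
        using nth_notin_take[OF n] by (simp add: set_take_Suc[OF n])
      also have "\<dots> = t I (Suc n) (restrict z (set (take (Suc n) \<pi>)))"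
        unfolding rk ratio_def upd Suc.IH[OF less_imp_le[OF n]] using t_pos[of I n ?x] by simp
      finally show ?case .
    qed (simp add: restrict_def)
    from this[of p] have "t I 0 (\<lambda>_. undefined) * (\<Prod>k\<in>{1..p}. r (cond_label E I k z)) = 1"
      by (simp add: set_\<pi> t_def tpoly_def)
    then show "s' (ASym I) * (\<Prod>k\<in>{1..p}. s' (cond_label E I k z)) =
        s (ASym I) * (\<Prod>k\<in>{1..p}. s (cond_label E I k z))"
      unfolding s'_cond prod.distrib by (simp add: s'_def mult_ac)
  qed
qed

lemma kernels_eq_if_tree_balanced:
  assumes tree_balanced
  shows "toric_kernel p d E \<I> = factorization_ideal p d E \<I>"
proof
  show "toric_kernel p d E \<I> \<subseteq> factorization_ideal p d E \<I>"
    unfolding toric_kernel_eq factorization_ideal_eq using N_0 by auto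
  show "factorization_ideal p d E \<I> \<subseteq> toric_kernel p d E \<I>"
  proof
    fix q assume "q \<in> factorization_ideal p d E \<I>"
    then have q: "in_vars (indets p d \<I>) q" "toric_map p E q \<in> N"
      unfolding factorization_ideal_eq mem_Collect_eq carrier_mpoly_ring by blast+
    have "toric_map p E q = 0"
    proof (rule mpoly_eq_0_if_vanishes)
      fix s :: "label \<Rightarrow> real" assume "\<And>l. 0 < s l"
      then obtain s' where s': "\<And>g. g \<in> sum_to_one p d E \<I> \<Longrightarrow> real.peval s' g = 0"
        "\<And>I z. I \<in> \<I> \<Longrightarrow> z \<in> states d {1..p} \<Longrightarrow>
          s' (ASym I) * (\<Prod>k\<in>{1..p}. s' (cond_label E I k z)) =
          s (ASym I) * (\<Prod>k\<in>{1..p}. s (cond_label E I k z))"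
        using stochastic_reweighting[OF assms] by metis
      \<comment> \<open>The toric monomials take equal values at \<open>s\<close> and
        \<open>s'\<close>, and the generators of \<open>N\<close> vanish at
        \<open>s'\<close>.\<close>
      have "real.peval s (toric_map p E q) = real.peval s' (toric_map p E q)"
        unfolding toric_map_def real_peval_hom
        by (rule real_peval_cong[OF q(1)]) (auto simp: indets_def s'(2) simp del: One_nat_def)
      also have "\<dots> = 0"
        using genideal_vanishes[OF q(2) sum_to_one_carrier s'(1)] .
      finally show "real.peval s (toric_map p E q) = 0" .
    qed
    then show "q \<in> toric_kernel p d E \<I>"
      using q(1) unfolding toric_kernel_eq mem_Collect_eq carrier_mpoly_ring by blast
  qed
qed

end

theorem theorem4p7:
  fixes p :: nat
    and d :: "nat \<Rightarrow> nat"
    and E :: "(nat \<times> nat) set"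
    and \<I> :: "nat set set"
    and \<pi> :: "nat list"
  assumes "dag p E"
    and "\<forall>k\<in>{1..p}. 2 \<le> d k"
    and "\<I> \<subseteq> Pow {1..p}"
    and "{} \<in> \<I>"
    and "linear_extension p E \<pi>"
  shows "(balanced (int_tree p d E \<I> \<pi>) \<longleftrightarrow>
            toric_kernel p d E \<I> = factorization_ideal p d E \<I>) \<and>
         (toric_kernel p d E \<I> = factorization_ideal p d E \<I> \<longleftrightarrow>
            perfect p E \<and> (\<forall>I\<in>\<I>. \<forall>J\<in>\<I>. I \<union> J = an_closure E (I \<union> J)))"
proof -
  interpret int_tree_setup p d E \<I> \<pi>
    by unfold_locales (rule assms)+
  \<comment> \<open>Both equivalences pass through \<open>tree_balanced\<close>, to which each of
    the three conditions is equivalent.\<close>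
  have "toric_kernel p d E \<I> = factorization_ideal p d E \<I> \<longleftrightarrow> tree_balanced"
    using kernels_eq_if_tree_balanced tree_balanced_if_kernels_eq by blast
  then show ?thesis
    by (simp only: balanced_iff tree_balanced_iff ancestral_iff)
qed

end
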